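(* Let $\mathcal{C}$ be the set of all functions $\rho\in C_+(I^2,\mathbb{R})$ such that there is no bi-Lipschitz map $\phi:I^2\to\mathbb{R}^2$ satisfying $\rho=Jac(\phi)$ almost everywhere. Then $\mathcal{C}$ is a thick subset of $C_+(I^2,\mathbb{R})$.
   Context: $I^2=[0,1]\times[0,1]$. $C_+(I^2,\mathbb{R})$ is the space of all positive continuous functions $\rho:I^2\to\mathbb{R}$, with the metric induced by the norm $\|f\|_0=\sup\{|f(x)|: x\in I^2\}$. A map $f:(X_1,d_1)\to(X_2,d_2)$ between metric spaces is $L$-bi-Lipschitz if $\frac1L d_1(x,y)\le d_2(f(x),f(y))\le L\,d_1(x,y)$ for all $x,y\in X_1$, and bi-Lipschitz if it is $L$-bi-Lipschitz for some $L\ge1$ (Euclidean metrics here). For a Lipschitz map $\phi:I^2\to\mathbb{R}^2$, $Jac(\phi)=\det D\phi$, defined almost everywhere by Rademacher's theorem. A subset $G$ of a metric space $M$ is thick if it contains a set of the form $\bigcap_{n\in\mathbb{N}}G_n$ with each $G_n$ an open dense subset of $M$. *)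

theory Defs
  imports "HOL-Analysis.Analysis"
begin

definition unit_square :: "(real^2) set" where
  "unit_square = {x. \<forall>i. 0 \<le> x $ i \<and> x $ i \<le> 1}"

text \<open>
  Elements of \<open>cfunspace\<close> are extensional: they take the value \<open>undefined\<close> outside the domain,
  so that they correspond bijectively to functions on the unit square.
\<close>

definition pos_cfunspace :: "((real^2) \<Rightarrow> real) metric" where
  "pos_cfunspace =
     submetric (cfunspace (top_of_set unit_square) euclidean_metric) {f. \<forall>x\<in>unit_square. 0 < f x}"

definition bi_lipschitz_with ::
    "real \<Rightarrow> 'a::metric_space set \<Rightarrow> ('a \<Rightarrow> 'b::metric_space) \<Rightarrow> bool" where
  "bi_lipschitz_with L S f \<longleftrightarrow>
     (\<forall>x\<in>S. \<forall>y\<in>S. 1 / L * dist x y \<le> dist (f x) (f y) \<and> dist (f x) (f y) \<le> L * dist x y)"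

definition bi_lipschitz_on ::
    "'a::metric_space set \<Rightarrow> ('a \<Rightarrow> 'b::metric_space) \<Rightarrow> bool" where
  "bi_lipschitz_on S f \<longleftrightarrow> (\<exists>L\<ge>1. bi_lipschitz_with L S f)"

definition jacobian_within :: "(real^'n \<Rightarrow> real^'n) \<Rightarrow> (real^'n) set \<Rightarrow> real^'n \<Rightarrow> real" where
  "jacobian_within \<phi> S x = det (matrix (frechet_derivative \<phi> (at x within S)))"

text \<open>
  The value of \<open>jacobian_within\<close> is meaningful only at points of differentiability, so an almost
  everywhere identity for the Jacobian includes differentiability at almost every point.  By
  Rademacher's theorem this is automatic for a Lipschitz map.  The derivative is taken within \<open>S\<close>
  because only the values of \<open>\<phi>\<close> on \<open>S\<close> matter; at interior points it is the usual one.
\<close>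

definition has_jacobian_ae ::
    "(real^'n \<Rightarrow> real^'n) \<Rightarrow> (real^'n \<Rightarrow> real) \<Rightarrow> (real^'n) set \<Rightarrow> bool" where
  "has_jacobian_ae \<phi> \<rho> S \<longleftrightarrow>
     (AE x in lebesgue_on S. \<phi> differentiable (at x within S) \<and> \<rho> x = jacobian_within \<phi> S x)"

definition thick_in :: "'a metric \<Rightarrow> 'a set \<Rightarrow> bool" where
  "thick_in m G \<longleftrightarrow> G \<subseteq> mspace m \<and>
     (\<exists>U :: nat \<Rightarrow> 'a set.
        (\<forall>n. openin (mtopology_of m) (U n) \<and> mtopology_of m closure_of U n = mspace m) \<and>
        (\<Inter>n. U n) \<subseteq> G)"

definition nonrealizable_densities :: "((real^2) \<Rightarrow> real) set" where
  "nonrealizable_densities =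
     {\<rho> \<in> mspace pos_cfunspace.
        \<not> (\<exists>\<phi> :: real^2 \<Rightarrow> real^2. bi_lipschitz_on unit_square \<phi> \<and> has_jacobian_ae \<phi> \<rho> unit_square)}"

lemma unit_square_eq_cbox: "unit_square = cbox 0 1"
  by (auto simp: unit_square_def mem_box_cart)

lemma mspace_pos_cfunspace:
  "mspace pos_cfunspace =
     {f \<in> extensional unit_square. continuous_on unit_square f \<and> (\<forall>x\<in>unit_square. 0 < f x)}"
proof -
  have "bounded (f ` unit_square)" if "continuous_on unit_square f" for f :: "real^2 \<Rightarrow> real"
    using that by (simp add: unit_square_eq_cbox compact_continuous_image compact_imp_bounded)
  then show ?thesis
    by (auto simp: pos_cfunspace_def)
qed

lemma mdist_pos_cfunspace:
  assumes "f \<in> mspace pos_cfunspace" "g \<in> mspace pos_cfunspace"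
  shows "mdist pos_cfunspace f g = (SUP x\<in>unit_square. \<bar>f x - g x\<bar>)"
proof -
  have "unit_square \<noteq> {}"
    by (auto simp: unit_square_def intro!: exI[of _ 0])
  then show ?thesis
    using assms by (simp add: pos_cfunspace_def mdist_cfunspace_eq_mdist_funspace
      mdist_funspace Met_TC.fdist_def Met_TC.fspace_def dist_real_def)
qed

end

theory Submission
  imports Defs
begin

text \<open>
  This is the construction of Burago--Kleiner and McMullen.  Fix \<open>L\<close>, a density \<open>\<rho>0\<close> and
  \<open>\<epsilon> > 0\<close>.  Suppose that an \<open>L\<close>-bi-Lipschitz map stretches a horizontal segment by a factor
  at least \<open>A\<close>.  Cut a thin strip along the segment into equal squares.  If no horizontal step between
  corresponding points of neighbouring squares is stretched by \<open>(1 + k) A\<close>, then on some pair of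
  neighbouring squares the map is almost the same up to a translation, so that the images of these squares
  have almost the same area.  A density that oscillates around \<open>\<rho>0\<close> with amplitude \<open>\<epsilon>\<close> from
  square to square excludes this, and so do all densities close to it.  Hence, starting from the stretching factor
  \<open>1 / L\<close> and repeating the perturbation at finer and finer scales, one finds densities
  \<open>\<epsilon>\<close>-close to \<open>\<rho>0\<close> such that every \<open>L\<close>-bi-Lipschitz map that realizes a density
  nearby stretches some segment by \<open>(1 + k)\<^sup>j / L\<close>.  This is absurd once it exceeds \<open>L\<close>.
  So the densities realizable with constant \<open>L\<close> are nowhere dense for each \<open>L\<close>.
\<close>

section \<open>Bi-Lipschitz maps and the areas of their images\<close>

text \<open>Integrated form of the Jacobian equation, tested on boxes only. Once
  \<open>transports_of_jacobian\<close> has produced it, the geometric argument works with distances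
  and areas alone.\<close>

definition transports :: "real \<Rightarrow> (real^2 \<Rightarrow> real) \<Rightarrow> (real^2 \<Rightarrow> real^2) \<Rightarrow> bool" where
  "transports L \<rho> \<phi> \<longleftrightarrow> bi_lipschitz_with L unit_square \<phi> \<and>
     (\<forall>a b. cbox a b \<subseteq> unit_square \<longrightarrow>
        measure lebesgue (\<phi> ` cbox a b) = integral (cbox a b) \<rho>)"

lemma bi_lipschitz_with_dist_le:
  "\<lbrakk>bi_lipschitz_with L S f; x \<in> S; y \<in> S\<rbrakk> \<Longrightarrow> dist (f x) (f y) \<le> L * dist x y"
  by (auto simp: bi_lipschitz_with_def)

lemma bi_lipschitz_with_dist_ge:
  "\<lbrakk>bi_lipschitz_with L S f; x \<in> S; y \<in> S\<rbrakk> \<Longrightarrow> dist x y / L \<le> dist (f x) (f y)"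
  by (auto simp: bi_lipschitz_with_def)

lemma bi_lipschitz_with_subset:
  "\<lbrakk>bi_lipschitz_with L S f; T \<subseteq> S\<rbrakk> \<Longrightarrow> bi_lipschitz_with L T f"
  by (auto simp: bi_lipschitz_with_def)

lemma bi_lipschitz_with_mono:
  assumes f: "bi_lipschitz_with L S f" and "1 \<le> L" "L \<le> L'"
  shows "bi_lipschitz_with L' S f"
proof -
  have "1 / L' * d \<le> 1 / L * d" "L * d \<le> L' * d" if "d \<ge> 0" for d
    using assms(2,3) that by (intro mult_right_mono; simp add: frac_le)+
  then show ?thesis
    using f unfolding bi_lipschitz_with_def by (meson order_trans zero_le_dist)
qed

lemma bi_lipschitz_with_inj_on:
  assumes "bi_lipschitz_with L S f" "1 \<le> L"
  shows "inj_on f S"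
proof (rule inj_onI)
  fix x y assume "x \<in> S" "y \<in> S" "f x = f y"
  then have "dist x y / L \<le> 0"
    using bi_lipschitz_with_dist_ge[OF assms(1)] by fastforce
  then show "x = y"
    using assms(2) by (simp add: divide_le_0_iff)
qed

lemma bi_lipschitz_with_continuous_on:
  assumes "bi_lipschitz_with L S f" "1 \<le> L"
  shows "continuous_on S f"
proof -
  have "L-lipschitz_on S f"
    using assms by (auto intro!: lipschitz_onI simp: bi_lipschitz_with_def)
  then show ?thesis
    by (rule lipschitz_on_continuous_on)
qed

text \<open>Change of variables on the box minus a null set that covers the points where
  differentiability or the Jacobian equation fails. Injectivity comes from the lower Lipschitz
  bound; the upper bound makes the image of the removed null set negligible.\<close>

lemma transports_of_jacobian:
  assumes L: "1 \<le> L" and \<phi>: "bi_lipschitz_with L unit_square \<phi>"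
    and J: "has_jacobian_ae \<phi> \<rho> unit_square"
    and \<rho>: "continuous_on unit_square \<rho>" "\<And>x. x \<in> unit_square \<Longrightarrow> 0 < \<rho> x"
  shows "transports L \<rho> \<phi>"
  unfolding transports_def
proof (intro conjI allI impI)
  let ?Q = unit_square
  fix a b :: "real^2"
  assume S: "cbox a b \<subseteq> ?Q"
  let ?S = "cbox a b"
  define P where "P x \<longleftrightarrow> \<phi> differentiable (at x within ?Q) \<and> \<rho> x = jacobian_within \<phi> ?Q x" for x
  have "AE x in lebesgue_on ?Q. P x"
    using J by (simp add: has_jacobian_ae_def P_def)
  then have "AE x in lebesgue. x \<in> ?Q \<longrightarrow> P x"
    by (subst (asm) AE_restrict_space_iff) (auto simp: unit_square_eq_cbox)
  then obtain N where N: "N \<in> null_sets lebesgue" "{x. \<not> (x \<in> ?Q \<longrightarrow> P x)} \<subseteq> N"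
    unfolding eventually_ae_filter by auto
  have negN: "negligible N"
    using N(1) by (simp add: negligible_iff_null_sets)
  let ?T = "?S - N"
  let ?D = "\<lambda>x. frechet_derivative \<phi> (at x within ?Q)"
  have PT: "P x" if "x \<in> ?T" for x
    using that N(2) S by blast
  have der: "(\<phi> has_derivative ?D x) (at x within ?T)" if "x \<in> ?T" for x
  proof -
    have "(\<phi> has_derivative ?D x) (at x within ?Q)"
      using PT[OF that] by (simp add: P_def frechet_derivative_works)
    then show ?thesis
      by (rule has_derivative_subset) (use S in auto)
  qed
  have inj: "inj_on \<phi> ?T"
    using bi_lipschitz_with_inj_on[OF \<phi> L] by (rule inj_on_subset) (use S in auto)
  have meas: "?T \<in> sets lebesgue"
    using N(1) by auto
  \<comment> \<open>Positivity of \<rho> removes the absolute value of the determinant. The constant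
    integrand lives in \<open>real^1\<close> because the change-of-variables rule is applied to
    vector-valued functions.\<close>
  have det: "\<bar>det (matrix (?D x))\<bar> *\<^sub>R (vec 1 :: real^1) = vec (\<rho> x)" if "x \<in> ?T" for x
    using PT[OF that] \<rho>(2)[of x] that S by (auto simp: P_def jacobian_within_def vec_eq_iff)
  have int\<rho>: "\<rho> absolutely_integrable_on ?S"
    by (intro absolutely_integrable_continuous continuous_on_subset[OF \<rho>(1) S])
  have aintT: "\<rho> absolutely_integrable_on ?T"
    using int\<rho> by (rule absolutely_integrable_spike_set)
      (use negN in \<open>auto intro: negligible_subset\<close>)
  have intT: "integral ?T \<rho> = integral ?S \<rho>"
    by (rule integral_spike_set) (use negN in \<open>auto intro: negligible_subset\<close>)
  have "(\<lambda>x. vec (\<rho> x) :: real^1) absolutely_integrable_on ?T"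
    using aintT by (simp add: absolutely_integrable_on_1_iff)
  then have "(\<lambda>x. \<bar>det (matrix (?D x))\<bar> *\<^sub>R (vec 1 :: real^1)) absolutely_integrable_on ?T"
    using det by (subst set_integrable_cong) auto
  then have eq: "integral (\<phi> ` ?T) (\<lambda>x. vec 1 :: real^1) = integral ?T (\<lambda>x. vec (\<rho> x))"
    using integral_change_of_variables[OF meas der inj, of "\<lambda>x. vec 1"] det
    by (metis (mono_tags, lifting) Henstock_Kurzweil_Integration.integral_cong)
  have lm: "\<phi> ` ?S \<in> lmeasurable"
    by (intro lmeasurable_compact compact_continuous_image compact_cbox)
      (use bi_lipschitz_with_continuous_on[OF \<phi> L] S in \<open>auto intro: continuous_on_subset\<close>)
  have neg': "negligible (\<phi> ` (?S \<inter> N))"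
  proof (rule negligible_locally_Lipschitz_image)
    show "negligible (?S \<inter> N)"
      using negN by (auto intro: negligible_subset)
    fix x assume "x \<in> ?S \<inter> N"
    then show "\<exists>T B. open T \<and> x \<in> T \<and> (\<forall>y\<in>?S \<inter> N \<inter> T. norm (\<phi> y - \<phi> x) \<le> B * norm (y - x))"
      using bi_lipschitz_with_dist_le[OF \<phi>] S
      by (intro exI[of _ UNIV] exI[of _ L]) (auto simp: dist_norm subset_iff)
  qed simp
  have neg: "negligible (\<phi> ` ?S - \<phi> ` ?T \<union> (\<phi> ` ?T - \<phi> ` ?S))"
    by (rule negligible_subset[OF neg']) auto
  have "measure lebesgue (\<phi> ` ?S) = integral (\<phi> ` ?S) (\<lambda>x. 1)"
    by (rule lmeasure_integral[OF lm])
  also have "\<dots> = integral (\<phi> ` ?T) (\<lambda>x. 1)"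
    by (rule integral_spike_set) (use neg in \<open>auto intro: negligible_subset\<close>)
  also have "\<dots> = integral ?T \<rho>"
    using eq by (simp add: integral_on_1_eq vec_eq_iff flip: vec_lambda_eta)
  finally show "measure lebesgue (\<phi> ` ?S) = integral ?S \<rho>"
    using intT by simp
qed (rule \<phi>)

section \<open>Comparing the areas of images of squares\<close>

text \<open>
  A point \<open>y = f x\<close> of the shrunk image has distance more than \<open>e\<close> from the boundary of the full
  image, by invariance of domain and the lower Lipschitz bound.  The map \<open>z \<mapsto> z - g (f\<inverse> z) + y\<close>
  therefore sends the ball of radius \<open>e\<close> around \<open>y\<close> to itself, and a Brouwer fixed point is
  a preimage of \<open>y\<close> under \<open>g\<close>.
\<close>

lemma image_shrunk_box_subset_of_close:
  fixes f g :: "real^'n \<Rightarrow> real^'n"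
  assumes L: "1 \<le> L" and f: "bi_lipschitz_with L (cbox a (a + w *\<^sub>R 1)) f"
    and g: "continuous_on (cbox a (a + w *\<^sub>R 1)) g"
    and fg: "\<And>x. x \<in> cbox a (a + w *\<^sub>R 1) \<Longrightarrow> dist (f x) (g x) \<le> e"
    and e: "0 < e" "e < t / L"
  shows "f ` cbox (a + t *\<^sub>R 1) (a + (w - t) *\<^sub>R 1) \<subseteq> g ` cbox a (a + w *\<^sub>R 1)"
proof
  let ?S = "cbox a (a + w *\<^sub>R 1)"
  fix y assume "y \<in> f ` cbox (a + t *\<^sub>R 1) (a + (w - t) *\<^sub>R 1)"
  then obtain x where y: "y = f x" and x: "x \<in> cbox (a + t *\<^sub>R 1) (a + (w - t) *\<^sub>R 1)"
    by auto
  have t: "0 < t"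
    using e L by (smt (verit) divide_nonpos_nonneg)
  have xS: "x \<in> ?S"
    using x t by (auto simp: mem_box_cart) (smt (verit, best))+
  have contf: "continuous_on ?S f" and inj: "inj_on f ?S"
    using bi_lipschitz_with_continuous_on[OF f L] bi_lipschitz_with_inj_on[OF f L] by auto
  have front: "t \<le> dist x z" if z: "z \<in> ?S" "z \<notin> box a (a + w *\<^sub>R 1)" for z
  proof -
    obtain i where "z $ i \<le> a $ i \<or> a $ i + w \<le> z $ i"
      using z(2) by (auto simp: mem_box_cart not_less)
    moreover have "a $ i + t \<le> x $ i" "x $ i \<le> a $ i + (w - t)"
      using x by (auto simp: mem_box_cart dest: spec[of _ i])
    ultimately have "t \<le> \<bar>(x - z) $ i\<bar>"
      by auto
    also have "\<dots> \<le> dist x z"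
      by (simp only: dist_norm component_le_norm_cart)
    finally show ?thesis .
  qed
  have op: "open (f ` box a (a + w *\<^sub>R 1))"
    by (rule invariance_of_domain)
      (use contf inj box_subset_cbox in \<open>blast intro: continuous_on_subset inj_on_subset\<close>)+
  have fr: "frontier (f ` ?S) \<subseteq> f ` (?S - box a (a + w *\<^sub>R 1))"
  proof -
    have "closed (f ` ?S)"
      by (intro compact_imp_closed compact_continuous_image contf compact_cbox)
    moreover have "f ` box a (a + w *\<^sub>R 1) \<subseteq> interior (f ` ?S)"
      by (intro interior_maximal op image_mono box_subset_cbox)
    ultimately show ?thesis
      by (auto simp: frontier_def)
  qed
  have far: "e < dist y u" if "u \<in> frontier (f ` ?S)" for u
  proof -
    have "u \<in> f ` (?S - box a (a + w *\<^sub>R 1))"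
      using fr that by blast
    then obtain z where z: "u = f z" "z \<in> ?S" "z \<notin> box a (a + w *\<^sub>R 1)"
      by blast
    have "t / L \<le> dist x z / L"
      using front[OF z(2,3)] L by (simp add: divide_right_mono)
    also have "\<dots> \<le> dist (f x) (f z)"
      by (rule bi_lipschitz_with_dist_ge[OF f xS z(2)])
    finally show ?thesis
      using e z y by simp
  qed
  \<comment> \<open>By connectedness, a ball that meets the image without lying in it would meet its
    frontier, but \<open>far\<close> puts the frontier at distance greater than \<open>e\<close>
    from \<open>y\<close>.\<close>
  have sub: "cball y e \<subseteq> f ` ?S"
  proof (rule ccontr)
    assume "\<not> ?thesis"
    moreover have "y \<in> cball y e \<inter> f ` ?S"
      using e(1) xS y by auto
    ultimately have "cball y e \<inter> frontier (f ` ?S) \<noteq> {}"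
      by (metis connected_Int_frontier connected_cball Diff_eq_empty_iff empty_iff)
    then show False
      using far by fastforce
  qed
  define h where "h = inv_into ?S f"
  have h: "h z \<in> ?S" "f (h z) = z" if "z \<in> f ` ?S" for z
    using that by (auto simp: h_def inv_into_into f_inv_into_f)
  have conth: "continuous_on (f ` ?S) h"
    by (rule continuous_on_inv[OF contf compact_cbox]) (use inj in \<open>simp add: h_def\<close>)
  have "continuous_on (f ` ?S) (\<lambda>z. g (h z))"
    by (rule continuous_on_compose2[OF g conth]) (use h in auto)
  then have "continuous_on (cball y e) (\<lambda>z. z - g (h z) + y)"
    by (intro continuous_intros continuous_on_subset[OF _ sub])
  moreover have "(\<lambda>z. z - g (h z) + y) \<in> cball y e \<rightarrow> cball y e"
  proof
    fix z assume "z \<in> cball y e"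
    then have "z \<in> f ` ?S"
      using sub by blast
    then have "dist z (g (h z)) \<le> e"
      using fg[OF h(1)] h(2) by metis
    then show "z - g (h z) + y \<in> cball y e"
      by (simp add: dist_norm norm_minus_commute)
  qed
  ultimately obtain z where z: "z \<in> cball y e" "z - g (h z) + y = z"
    using brouwer_ball[OF e(1)] by blast
  then have "g (h z) = y"
    by (simp add: algebra_simps)
  then show "y \<in> g ` ?S"
    using h(1)[of z] z sub by blast
qed

text \<open>The image of the first square, shrunk by \<open>\<tau> * w\<close> on every side, is
  carried by the translation \<open>T\<close> into the image of the second square. The frame lost by
  shrinking has area at most \<open>4 * \<tau> * w\<^sup>2\<close>, and \<rho> is at most
  \<open>C\<close> there. The bound is one-sided; exchanging the squares gives the other
  one.\<close>

lemma integral_square_le_of_near_translation: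
  fixes \<phi> :: "real^2 \<Rightarrow> real^2"
  assumes L: "1 \<le> L" and \<phi>: "transports L \<rho> \<phi>"
    and \<rho>: "continuous_on unit_square \<rho>" "\<And>x. x \<in> unit_square \<Longrightarrow> \<rho> x \<le> C"
    and w: "0 < w" and \<tau>: "0 < \<tau>" "\<tau> \<le> 1/2" and C: "0 \<le> C"
    and S: "cbox a (a + w *\<^sub>R 1) \<subseteq> unit_square"
    and S': "cbox (a + d) (a + d + w *\<^sub>R 1) \<subseteq> unit_square"
    and near: "\<And>x. x \<in> cbox a (a + w *\<^sub>R 1) \<Longrightarrow> norm (\<phi> (x + d) - \<phi> x - T) \<le> e"
    and e: "0 < e" "e < \<tau> * w / L"
  shows "integral (cbox a (a + w *\<^sub>R 1)) \<rho>
    \<le> integral (cbox (a + d) (a + d + w *\<^sub>R 1)) \<rho> + 4 * C * \<tau> * w\<^sup>2"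
proof -
  let ?S = "cbox a (a + w *\<^sub>R 1)" and ?S' = "cbox (a + d) (a + d + w *\<^sub>R 1)"
  let ?t = "\<tau> * w"
  let ?St = "cbox (a + ?t *\<^sub>R 1) (a + (w - ?t) *\<^sub>R 1)"
  have bil: "bi_lipschitz_with L unit_square \<phi>"
    and meas: "\<And>a b. cbox a b \<subseteq> unit_square \<Longrightarrow>
      measure lebesgue (\<phi> ` cbox a b) = integral (cbox a b) \<rho>"
    using \<phi> by (auto simp: transports_def)
  have cont: "continuous_on unit_square \<phi>"
    by (rule bi_lipschitz_with_continuous_on[OF bil L])
  have tw: "0 < ?t" "2 * ?t \<le> w"
    using w \<tau> by auto
  have sub: "?St \<subseteq> ?S"
  proof
    fix x assume "x \<in> ?St"
    then have "a $ i + ?t \<le> x $ i \<and> x $ i \<le> a $ i + (w - ?t)" for i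
      by (auto simp: mem_box_cart)
    then have "a $ i \<le> x $ i \<and> x $ i \<le> a $ i + w" for i
      using tw by (smt (verit, best))
    then show "x \<in> ?S"
      by (simp add: mem_box_cart)
  qed
  have trans: "(\<lambda>x. x + d) ` ?S = ?S'"
    using cbox_translation[of d a "a + w *\<^sub>R 1"] by (simp add: add_ac)
  have "(\<lambda>x. \<phi> x + T) ` ?St \<subseteq> (\<lambda>x. \<phi> (x + d)) ` ?S"
  proof (rule image_shrunk_box_subset_of_close[OF L])
    show "bi_lipschitz_with L ?S (\<lambda>x. \<phi> x + T)"
      using bi_lipschitz_with_subset[OF bil S] by (simp add: bi_lipschitz_with_def)
    show "continuous_on ?S (\<lambda>x. \<phi> (x + d))"
      by (rule continuous_on_compose2[OF cont]) (use trans S' in \<open>auto intro!: continuous_intros\<close>)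
    show "dist (\<phi> x + T) (\<phi> (x + d)) \<le> e" if "x \<in> ?S" for x
      using near[OF that] by (simp add: dist_norm norm_minus_commute algebra_simps)
  qed (use e in auto)
  then have "(+) T ` \<phi> ` ?St \<subseteq> \<phi> ` ?S'"
    unfolding trans[symmetric] by (auto simp: add.commute image_iff subset_iff)
  moreover have "\<phi> ` ?S' \<in> lmeasurable" "(+) T ` \<phi> ` ?St \<in> lmeasurable"
    using S S' sub
    by (auto intro!: lmeasurable_compact compact_translation compact_continuous_image
        intro: continuous_on_subset[OF cont])
  ultimately have "measure lebesgue ((+) T ` \<phi> ` ?St) \<le> measure lebesgue (\<phi> ` ?S')"
    by (intro measure_mono_fmeasurable) auto
  then have 1: "integral ?St \<rho> \<le> integral ?S' \<rho>"
    using meas[of "a + ?t *\<^sub>R 1"] meas[OF S'] sub S by (simp add: measure_translation)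
  have int: "\<rho> integrable_on ?S" "\<rho> integrable_on ?St"
    using S sub by (auto intro!: integrable_continuous intro: continuous_on_subset[OF \<rho>(1)])
  \<comment> \<open>Monotonicity in the domain requires a nonnegative integrand, which the upper
    bound on \<rho> supplies in the form \<open>C - \<rho> x\<close>.\<close>
  have "integral ?St (\<lambda>x. C - \<rho> x) \<le> integral ?S (\<lambda>x. C - \<rho> x)"
    by (rule integral_subset_le[OF sub])
      (use int S \<rho>(2) in \<open>auto intro!: integrable_diff\<close>)
  then have 2: "measure lborel ?St * C - integral ?St \<rho> \<le> measure lborel ?S * C - integral ?S \<rho>"
    using int by (subst (asm) (1 2) Henstock_Kurzweil_Integration.integral_diff) auto
  have ne: "?S \<noteq> {}" "?St \<noteq> {}"
    using w \<tau> by (auto simp: interval_eq_empty_cart not_less)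
  have "measure lborel ?S = w\<^sup>2" "measure lborel ?St = (w - 2 * ?t)\<^sup>2"
    using ne by (simp_all add: content_cbox_cart power2_eq_square UNIV_2 algebra_simps)
  moreover have "w\<^sup>2 - (w - 2 * ?t)\<^sup>2 \<le> 4 * \<tau> * w\<^sup>2"
    using \<tau>(1) by (simp add: power2_eq_square algebra_simps)
  then have "(w\<^sup>2 - (w - 2 * ?t)\<^sup>2) * C \<le> 4 * \<tau> * w\<^sup>2 * C"
    by (rule mult_right_mono) (rule C)
  ultimately show ?thesis
    using 1 2 by (simp add: algebra_simps)
qed

section \<open>Rows of squares and nearly equal steps\<close>

text \<open>Expanding the square, the cross term almost cancels the other two. Thus a step whose
  length cannot exceed \<open>K\<close>, but whose component along \<open>v\<close> almost reaches
  \<open>K\<close>, is determined up to an error of the order of the square root of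
  \<open>d\<close>.\<close>

lemma norm_diff_scaleR_square_le:
  fixes x v :: "'a::real_inner"
  assumes "norm v = 1" "norm x \<le> K" "K - d \<le> x \<bullet> v" 
  shows "(norm (x - K *\<^sub>R v))\<^sup>2 \<le> 2 * K * d"
proof -
  have K: "0 \<le> K"
    using assms(2) norm_ge_zero order_trans by blast
  have "(norm (x - K *\<^sub>R v))\<^sup>2 = (norm x)\<^sup>2 - 2 * K * (x \<bullet> v) + K\<^sup>2 * (norm v)\<^sup>2"
    unfolding power2_norm_eq_inner
    by (simp add: inner_diff_left inner_diff_right inner_commute power2_eq_square algebra_simps)
  also have "\<dots> \<le> K\<^sup>2 - 2 * K * (K - d) + K\<^sup>2"
    using assms K by (intro add_mono diff_mono mult_left_mono power_mono) auto
  also have "\<dots> = 2 * K * d"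
    by (simp add: power2_eq_square algebra_simps)
  finally show ?thesis .
qed

lemma exists_le_average:
  fixes f :: "nat \<Rightarrow> real"
  assumes "0 < N" "sum f {..<N} \<le> real N * s"
  obtains i where "i < N" "f i \<le> s"
proof -
  have "\<exists>i<N. f i \<le> s"
  proof (rule ccontr)
    assume "\<not> ?thesis"
    then have "(\<Sum>i<N. s) < sum f {..<N}"
      using assms(1) by (intro sum_strict_mono) auto
    then show False
      using assms(2) by simp
  qed
  then show thesis
    using that by blast
qed

lemma finite_net_unit_square:
  assumes "0 < r"
  obtains G where "finite G" "G \<subseteq> unit_square" "\<And>x. x \<in> unit_square \<Longrightarrow> \<exists>u\<in>G. dist u x < r"
proof -
  have "seq_compact unit_square"
    by (simp add: unit_square_eq_cbox compact_imp_seq_compact)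
  then obtain G where "finite G" "G \<subseteq> unit_square" "unit_square \<subseteq> (\<Union>u\<in>G. ball u r)"
    using seq_compact_imp_totally_bounded assms by metis
  then show thesis
    by (intro that[of G]) (auto simp: subset_iff)
qed

text \<open>Coordinates on a row of squares of side \<open>w\<close> with lower left corner
  \<open>p\<close>: \<open>i\<close> selects the square and \<open>u\<close> in the unit square is
  the relative position in it. Corresponding points of neighbouring squares share the same
  \<open>u\<close>.\<close>

definition grid_point :: "real^2 \<Rightarrow> real \<Rightarrow> nat \<Rightarrow> real^2 \<Rightarrow> real^2" where
  "grid_point p w i u = p + w *\<^sub>R (real i *\<^sub>R axis 1 1 + u)"

definition cell :: "real^2 \<Rightarrow> real \<Rightarrow> nat \<Rightarrow> (real^2) set" where
  "cell p w i = cbox (grid_point p w i 0) (grid_point p w i 0 + w *\<^sub>R 1)"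

lemma grid_point_Suc: "grid_point p w (Suc i) u = grid_point p w i u + w *\<^sub>R axis 1 1"
  by (simp add: grid_point_def algebra_simps)

lemma cell_eq_image:
  assumes "0 < w"
  shows "cell p w i = grid_point p w i ` unit_square"
proof -
  have "(0::real^2) \<in> cbox 0 1"
    by (simp add: mem_box_cart)
  then have "cell p w i = (\<lambda>u. w *\<^sub>R u + grid_point p w i 0) ` cbox 0 1"
    using assms image_affinity_cbox[of w "grid_point p w i 0" 0 1]
    by (auto simp: cell_def add.commute)
  also have "\<dots> = grid_point p w i ` unit_square"
    unfolding unit_square_eq_cbox by (rule image_cong) (simp_all add: grid_point_def algebra_simps)
  finally show ?thesis .
qed

text \<open>The row has the \<open>N + 1\<close> squares with indices \<open>0\<close> to
  \<open>N\<close>, hence the length \<open>(real N + 1) * w\<close>; it has only \<open>N\<close>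
  pairs of neighbours, which are indexed by \<open>i < N\<close>.\<close>

lemma grid_point_in_unit_square:
  assumes "i \<le> N" "0 < w" "u \<in> unit_square"
    and "0 \<le> p $ 1" "p $ 1 + (real N + 1) * w \<le> 1" "0 \<le> p $ 2" "p $ 2 + w \<le> 1"
  shows "grid_point p w i u \<in> unit_square"
proof -
  have u: "0 \<le> u $ 1" "u $ 1 \<le> 1" "0 \<le> u $ 2" "u $ 2 \<le> 1"
    using assms(3) by (auto simp: unit_square_def)
  then have "w * (real i + u $ 1) \<le> w * (real N + 1)" "w * u $ 2 \<le> w"
    using assms(1,2) by (auto simp: mult_le_cancel_left1)
  moreover have "0 \<le> w * (real i + u $ 1)" "0 \<le> w * u $ 2"
    using u assms(2) by auto
  moreover have "grid_point p w i u $ 1 = p $ 1 + w * (real i + u $ 1)"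
      "grid_point p w i u $ 2 = p $ 2 + w * u $ 2"
    by (simp_all add: grid_point_def axis_def)
  ultimately have "0 \<le> grid_point p w i u $ j \<and> grid_point p w i u $ j \<le> 1" for j
    using assms(4-7) exhaust_2[of j] by (auto simp: mult.commute simp del: mult_le_cancel_left1 mult_le_cancel_left2)
  then show ?thesis
    by (simp add: unit_square_def)
qed

lemma cell_subset_unit_square:
  assumes "i \<le> N" "0 < w"
    and "0 \<le> p $ 1" "p $ 1 + (real N + 1) * w \<le> 1" "0 \<le> p $ 2" "p $ 2 + w \<le> 1"
  shows "cell p w i \<subseteq> unit_square"
  using grid_point_in_unit_square[OF assms(1,2) _ assms(3-)] cell_eq_image[OF assms(2)] by auto

lemma norm_le_2_of_components:
  fixes x :: "real^2"
  assumes "\<bar>x $ 1\<bar> \<le> 1" "\<bar>x $ 2\<bar> \<le> 1"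
  shows "norm x \<le> 2"
  using norm_le_l1_cart[of x] assms by (simp add: UNIV_2)

text \<open>
  The steps of the grid paths starting at \<open>grid_point p w 0 u\<close> add up to almost the displacement
  of the whole segment, in its direction \<open>v\<close>.  As no single step is much longer than the average,
  almost every step must be close to the average vector, and averaging over the steps yields an index
  that is good for all \<open>u \<in> G\<close> at once.
\<close>

lemma exists_uniformly_stretched_step:
  fixes \<phi> :: "real^2 \<Rightarrow> real^2"
  assumes L: "1 \<le> L" and bil: "bi_lipschitz_with L unit_square \<phi>"
    and G: "finite G" "G \<noteq> {}" "G \<subseteq> unit_square"
    and N: "0 < N" and w: "0 < w"
    and p: "0 \<le> p $ 1" "p $ 1 + (real N + 1) * w \<le> 1" "0 \<le> p $ 2" "p $ 2 + w \<le> 1"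
    and A: "0 < A" "A * ((real N + 1) * w) \<le> dist (\<phi> p) (\<phi> (p + ((real N + 1) * w) *\<^sub>R axis 1 1))"
    and k: "0 \<le> k" "k \<le> 1" "card G * (k * L + 4 * L / N) \<le> \<theta>"
    and short: "\<And>i u. \<lbrakk>i < N; u \<in> G\<rbrakk> \<Longrightarrow>
      dist (\<phi> (grid_point p w i u)) (\<phi> (grid_point p w (Suc i) u)) \<le> (1 + k) * A * w"
  obtains T i where "i < N" "\<And>u. u \<in> G \<Longrightarrow>
      (norm (\<phi> (grid_point p w (Suc i) u) - \<phi> (grid_point p w i u) - T))\<^sup>2 \<le> 4 * L * \<theta> * w\<^sup>2"
proof -
  let ?z = "grid_point p w" and ?l = "(real N + 1) * w"
  let ?q = "p + ?l *\<^sub>R axis 1 1"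
  \<comment> \<open>\<open>v\<close> is the direction of the total displacement, \<open>K\<close>
    the longest step that \<open>short\<close> admits, and \<open>D i u\<close> the nonnegative
    deficit of a step measured along \<open>v\<close>.\<close>
  define v where "v = sgn (\<phi> ?q - \<phi> p)"
  define K where "K = (1 + k) * A * w"
  define D where "D i u = K - (\<phi> (?z (Suc i) u) - \<phi> (?z i u)) \<bullet> v" for i u
  have l: "0 < ?l"
    using w by (simp add: add_pos_nonneg)
  have zin: "?z i u \<in> unit_square" if "i \<le> N" "u \<in> unit_square" for i u
    using grid_point_in_unit_square[OF that(1) w that(2) p] .
  have "p $ 1 \<le> 1" "p $ 2 \<le> 1" "0 \<le> p $ 1 + ?l"
    using p l w by linarith+
  then have pq: "p \<in> unit_square" "?q \<in> unit_square"
    using p by (auto simp: unit_square_def forall_2 axis_def)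
  have distpq: "dist p ?q = ?l"
    using l by (simp add: dist_norm norm_axis_1)
  have ne: "\<phi> ?q - \<phi> p \<noteq> 0"
    using A l by (metis dist_eq_0_iff eq_iff_diff_eq_0 mult_pos_pos not_less)
  then have v: "norm v = 1"
    by (simp add: v_def norm_sgn)
  have vpq: "(\<phi> ?q - \<phi> p) \<bullet> v = dist (\<phi> p) (\<phi> ?q)"
  proof -
    have "x \<bullet> sgn x = norm x" for x :: "real^2"
      by (cases "x = 0") (simp_all add: sgn_div_norm dot_square_norm power2_eq_square)
    then show ?thesis
      by (simp only: v_def dist_norm norm_minus_commute)
  qed
  have "A * ?l \<le> L * ?l"
    using A(2) bi_lipschitz_with_dist_le[OF bil pq] unfolding distpq by (rule order_trans)
  then have AL: "A \<le> L"
    using l by (simp add: mult_le_cancel_right_pos)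
  have Cauchy: "x \<bullet> v \<le> norm x" "- norm x \<le> x \<bullet> v" for x
    using Cauchy_Schwarz_ineq2[of x v] v by auto
  have D0: "0 \<le> D i u" if "i < N" "u \<in> G" for i u
    using Cauchy(1)[of "\<phi> (?z (Suc i) u) - \<phi> (?z i u)"] short[OF that]
    by (simp add: D_def K_def dist_norm norm_minus_commute)
  \<comment> \<open>The steps telescope. The path for \<open>u\<close> starts within
    \<open>2 * w\<close> of \<open>p\<close> and ends within \<open>2 * w\<close> of
    \<open>?q\<close>, which costs \<open>4 * L * w\<close> in the image. It makes \<open>N\<close>
    steps while the segment has length \<open>(real N + 1) * w\<close>; the resulting term
    \<open>- A * w\<close> has the favourable sign and is dropped.\<close>
  have total: "(\<Sum>i<N. D i u) \<le> N * (k * L + 4 * L / N) * w" if u: "u \<in> G" for u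
  proof -
    have uQ: "u \<in> unit_square" "\<bar>u $ 1\<bar> \<le> 1" "\<bar>u $ 2\<bar> \<le> 1" "\<bar>(u - axis 1 1) $ 1\<bar> \<le> 1" "\<bar>(u - axis 1 1) $ 2\<bar> \<le> 1"
      using u G(3) by (auto simp: unit_square_def axis_def subset_iff forall_2 abs_le_iff)
    have "norm (?z 0 u - p) = w * norm u"
      using w by (simp add: grid_point_def)
    also have "\<dots> \<le> w * 2"
      using norm_le_2_of_components uQ w by (intro mult_left_mono) auto
    finally have "L * dist (?z 0 u) p \<le> L * (2 * w)"
      using L by (simp add: dist_norm)
    then have 0: "norm (\<phi> (?z 0 u) - \<phi> p) \<le> 2 * L * w"
      using bi_lipschitz_with_dist_le[OF bil zin[of 0, OF _ uQ(1)] pq(1)]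
      by (simp add: dist_norm)
    have "?z N u - ?q = w *\<^sub>R (u - axis 1 1)"
      by (simp add: grid_point_def algebra_simps)
    then have "norm (?z N u - ?q) = w * norm (u - axis 1 1)"
      using w by simp
    also have "\<dots> \<le> w * 2"
      using norm_le_2_of_components uQ w by (intro mult_left_mono) auto
    finally have "L * dist (?z N u) ?q \<le> L * (2 * w)"
      using L by (simp add: dist_norm)
    then have 1: "norm (\<phi> (?z N u) - \<phi> ?q) \<le> 2 * L * w"
      using bi_lipschitz_with_dist_le[OF bil zin[of N, OF _ uQ(1)] pq(2)]
      by (simp add: dist_norm)
    have "(\<Sum>i<N. (\<phi> (?z (Suc i) u) - \<phi> (?z i u)) \<bullet> v) = (\<phi> (?z N u) - \<phi> (?z 0 u)) \<bullet> v"
      using sum_lessThan_telescope[of "\<lambda>i. \<phi> (?z i u) \<bullet> v" N] by (simp add: inner_diff_left)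
    also have "\<dots> = (\<phi> ?q - \<phi> p) \<bullet> v + (\<phi> (?z N u) - \<phi> ?q) \<bullet> v - (\<phi> (?z 0 u) - \<phi> p) \<bullet> v"
      by (simp add: inner_diff_left)
    also have "\<dots> \<ge> A * ?l - 2 * L * w - 2 * L * w"
      using A(2) vpq 0 1 Cauchy[of "\<phi> (?z N u) - \<phi> ?q"] Cauchy[of "\<phi> (?z 0 u) - \<phi> p"] by linarith
    finally have "(\<Sum>i<N. D i u) \<le> N * K - (A * ?l - 4 * L * w)"
      by (simp add: D_def sum_subtractf)
    also have "\<dots> = N * w * k * A + 4 * L * w - A * w"
      by (simp add: K_def algebra_simps)
    also have "\<dots> \<le> N * w * k * L + 4 * L * w"
    proof -
      have "N * w * k * A \<le> N * w * k * L" "0 \<le> A * w"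
        using A(1) AL k w by (auto intro!: mult_left_mono)
      then show ?thesis
        by linarith
    qed
    also have "\<dots> = N * (k * L + 4 * L / N) * w"
      using N by (simp add: field_simps)
    finally show ?thesis .
  qed
  \<comment> \<open>Since the deficits are nonnegative, an index whose total over \<open>G\<close>
    is small has a small deficit for every single \<open>u\<close> in \<open>G\<close>.\<close>
  have "(\<Sum>i<N. \<Sum>u\<in>G. D i u) = (\<Sum>u\<in>G. \<Sum>i<N. D i u)"
    by (rule sum.swap)
  also have "\<dots> \<le> (\<Sum>u\<in>G. N * (k * L + 4 * L / N) * w)"
    by (intro sum_mono total)
  also have "\<dots> = N * ((card G * (k * L + 4 * L / N)) * w)"
    by (simp add: algebra_simps)
  also have "\<dots> \<le> N * (\<theta> * w)"
    using k(3) w by (intro mult_left_mono mult_right_mono) auto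
  finally obtain i where i: "i < N" "(\<Sum>u\<in>G. D i u) \<le> \<theta> * w"
    using exists_le_average[OF N] by blast
  show thesis
  proof (rule that[OF i(1)])
    fix u assume u: "u \<in> G"
    have "D i u \<le> (\<Sum>u\<in>G. D i u)"
      using D0[OF i(1)] u G(1) by (intro member_le_sum) auto
    then have Du: "D i u \<le> \<theta> * w"
      using i(2) by simp
    have "(norm (\<phi> (?z (Suc i) u) - \<phi> (?z i u) - K *\<^sub>R v))\<^sup>2 \<le> 2 * K * (\<theta> * w)"
    proof (rule norm_diff_scaleR_square_le[OF v])
      show "norm (\<phi> (?z (Suc i) u) - \<phi> (?z i u)) \<le> K"
        using short[OF i(1) u] by (simp add: K_def dist_norm norm_minus_commute)
      show "K - \<theta> * w \<le> (\<phi> (?z (Suc i) u) - \<phi> (?z i u)) \<bullet> v"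
        using Du by (simp add: D_def)
    qed
    also have "\<dots> \<le> 2 * (2 * L * w) * (\<theta> * w)"
    proof (intro mult_right_mono mult_left_mono)
      have "(1 + k) * A \<le> 2 * L"
        using k A AL by (intro mult_mono) auto
      then show "K \<le> 2 * L * w"
        using w by (simp add: K_def)
      show "0 \<le> \<theta> * w"
        using D0[OF i(1) u] Du by linarith
    qed auto
    finally show "(norm (\<phi> (?z (Suc i) u) - \<phi> (?z i u) - K *\<^sub>R v))\<^sup>2 \<le> 4 * L * \<theta> * w\<^sup>2"
      by (simp add: power2_eq_square algebra_simps)
  qed
qed

text \<open>An index that is good for the net \<open>G\<close> is good on the whole square by the
  Lipschitz bound, and comparing areas in both directions gives the estimate. The constants
  \<open>G\<close>, \<open>k\<close> and \<open>N0\<close> depend only on \<open>L\<close>,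
  \<open>c\<close> and \<open>C\<close>, not on scale, position, \<open>A\<close>, \<rho> or \<phi>,
  so that each round of the later iteration gains the same factor \<open>1 + k\<close>.\<close>

lemma rigidity:
  fixes L c C :: real
  assumes L: "1 \<le> L" and c: "0 < c" and C: "0 < C"
  obtains G k N0 where "finite G" "G \<subseteq> unit_square" "0 < k"
    "\<And>N w p A \<rho> \<phi>.
      \<lbrakk>N0 \<le> N; 0 < w; 0 \<le> p $ 1; p $ 1 + (real N + 1) * w \<le> 1; 0 \<le> p $ 2; p $ 2 + w \<le> 1;
       transports L \<rho> \<phi>; continuous_on unit_square \<rho>; \<And>x. x \<in> unit_square \<Longrightarrow> \<rho> x \<le> C;
       0 < A; A * ((real N + 1) * w) \<le> dist (\<phi> p) (\<phi> (p + ((real N + 1) * w) *\<^sub>R axis 1 1));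
       \<And>i u. \<lbrakk>i < N; u \<in> G\<rbrakk> \<Longrightarrow>
         dist (\<phi> (grid_point p w i u)) (\<phi> (grid_point p w (Suc i) u)) \<le> (1 + k) * A * w\<rbrakk>
      \<Longrightarrow> \<exists>i<N. \<bar>integral (cell p w i) \<rho> - integral (cell p w (Suc i)) \<rho>\<bar> \<le> c * w\<^sup>2"
proof -
  \<comment> \<open>The constants are chosen backwards: \<tau> keeps the error from the lost frame
    below \<open>c * w\<^sup>2\<close>, \<eta> is the tolerated deviation from a translation
    relative to \<open>w\<close>, and \<theta> yields the deviation \<open>\<eta> / 2\<close> on the
    net. Then \<open>k\<close> and \<open>N0\<close> use up half of \<theta> each.\<close>
  define \<tau> where "\<tau> = min (1/2) (c / (4 * C))"
  define \<eta> where "\<eta> = \<tau> / (2 * L)"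
  define \<theta> where "\<theta> = \<eta>\<^sup>2 / (16 * L)"
  have \<tau>: "0 < \<tau>" "\<tau> \<le> 1/2" "4 * C * \<tau> \<le> c"
    using c C by (auto simp: \<tau>_def min_def field_simps)
  have \<eta>: "0 < \<eta>" "\<eta> < \<tau> / L"
    using \<tau> L by (auto simp: \<eta>_def field_simps)
  have \<theta>: "0 < \<theta>" "4 * L * \<theta> = (\<eta> / 2)\<^sup>2"
    using \<eta> L by (auto simp: \<theta>_def field_simps power2_eq_square)
  have "0 < \<eta> / (4 * L)"
    using \<eta> L by simp
  then obtain G where G: "finite G" "G \<subseteq> unit_square"
    and net: "\<And>x. x \<in> unit_square \<Longrightarrow> \<exists>u\<in>G. dist u x < \<eta> / (4 * L)"
    using finite_net_unit_square by blast
  have "(0::real^2) \<in> unit_square"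
    by (simp add: unit_square_def)
  then have Gne: "G \<noteq> {}"
    using net by blast
  define n where "n = real (card G)"
  have n: "1 \<le> n"
    using G(1) Gne by (simp add: n_def Suc_le_eq card_gt_0_iff)
  define k where "k = min 1 (\<theta> / (2 * n * L))"
  have k: "0 < k" "k \<le> 1" "n * (k * L) \<le> \<theta> / 2"
    using \<theta> n L by (auto simp: k_def min_def field_simps)
  obtain N0 :: nat where N0: "8 * n * L / \<theta> < N0"
    using reals_Archimedean2 by blast
  have "0 < 8 * n * L / \<theta>"
    using n L \<theta> by simp
  then have N0pos: "0 < N0"
    using N0 by (metis less_trans of_nat_0_less_iff)
  show thesis
  proof (rule that[OF G k(1), of N0])
    fix N w p A \<rho> and \<phi> :: "real^2 \<Rightarrow> real^2"
    assume N: "N0 \<le> N" and w: "0 < w"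
      and p: "0 \<le> p $ 1" "p $ 1 + (real N + 1) * w \<le> 1" "0 \<le> p $ 2" "p $ 2 + w \<le> 1"
      and \<phi>: "transports L \<rho> \<phi>"
      and \<rho>: "continuous_on unit_square \<rho>" "\<And>x. x \<in> unit_square \<Longrightarrow> \<rho> x \<le> C"
      and A: "0 < A" "A * ((real N + 1) * w) \<le> dist (\<phi> p) (\<phi> (p + ((real N + 1) * w) *\<^sub>R axis 1 1))"
      and short: "\<And>i u. \<lbrakk>i < N; u \<in> G\<rbrakk> \<Longrightarrow>
         dist (\<phi> (grid_point p w i u)) (\<phi> (grid_point p w (Suc i) u)) \<le> (1 + k) * A * w"
    let ?z = "grid_point p w"
    have Npos: "0 < N"
      using N N0pos by simp
    have bil: "bi_lipschitz_with L unit_square \<phi>"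
      using \<phi> by (simp add: transports_def)
    have "8 * n * L \<le> \<theta> * N0"
      using N0 \<theta>(1) by (simp add: field_simps)
    also have "\<dots> \<le> \<theta> * N"
      using N \<theta>(1) by simp
    finally have "n * (4 * L / N) \<le> \<theta> / 2"
      using Npos by (simp add: field_simps)
    then have "card G * (k * L + 4 * L / N) \<le> \<theta>"
      using k(3) by (simp add: n_def distrib_left)
    then obtain T i where i: "i < N" and T: "\<And>u. u \<in> G \<Longrightarrow>
      (norm (\<phi> (?z (Suc i) u) - \<phi> (?z i u) - T))\<^sup>2 \<le> 4 * L * \<theta> * w\<^sup>2"
      using exists_uniformly_stretched_step[OF L bil G(1) Gne G(2) Npos w p A _ k(2) _ short] k(1)
      by (metis less_imp_le)
    have T': "norm (\<phi> (?z (Suc i) u) - \<phi> (?z i u) - T) \<le> \<eta> / 2 * w" if "u \<in> G" for u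
    proof (rule power2_le_imp_le)
      show "(norm (\<phi> (?z (Suc i) u) - \<phi> (?z i u) - T))\<^sup>2 \<le> (\<eta> / 2 * w)\<^sup>2"
        using T[OF that] \<theta>(2) by (simp only: power_mult_distrib)
    qed (use \<eta> w in simp)
    have zin: "?z j u \<in> unit_square" if "j \<le> N" "u \<in> unit_square" for j u
      using grid_point_in_unit_square[OF that(1) w that(2) p] .
    have near: "norm (\<phi> (x + w *\<^sub>R axis 1 1) - \<phi> x - T) \<le> \<eta> * w" if x: "x \<in> cell p w i" for x
    proof -
      obtain y where y: "y \<in> unit_square" "x = ?z i y"
        using x cell_eq_image[OF w] by auto
      obtain u where u: "u \<in> G" "dist u y < \<eta> / (4 * L)"
        using net[OF y(1)] by blast
      \<comment> \<open>Moving to a net point costs \<open>\<eta> / 4 * w\<close> at either end of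
        the step; together with \<open>\<eta> / 2 * w\<close> on the net this makes
        \<open>\<eta> * w\<close>.\<close>
      have close: "norm (\<phi> (?z j y) - \<phi> (?z j u)) \<le> \<eta> / 4 * w" if "j \<le> N" for j
      proof -
        have "dist (?z j y) (?z j u) = w * dist u y"
          using w unfolding grid_point_def dist_norm
          by (simp add: norm_minus_commute flip: scaleR_diff_right)
        also have "\<dots> \<le> w * (\<eta> / (4 * L))"
          using u(2) w by (intro mult_left_mono) auto
        finally have "L * dist (?z j y) (?z j u) \<le> L * (w * (\<eta> / (4 * L)))"
          using L by (intro mult_left_mono) auto
        also have "\<dots> = \<eta> / 4 * w"
          using L by simp
        finally show ?thesis
          using bi_lipschitz_with_dist_le[OF bil zin[OF that y(1)] zin[OF that, of u]] u(1) G(2)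
          by (auto simp: dist_norm)
      qed
      have "\<phi> (x + w *\<^sub>R axis 1 1) - \<phi> x - T = (\<phi> (?z (Suc i) u) - \<phi> (?z i u) - T)
          + (\<phi> (?z (Suc i) y) - \<phi> (?z (Suc i) u)) - (\<phi> (?z i y) - \<phi> (?z i u))"
        by (simp add: y(2) grid_point_Suc)
      also have "norm \<dots> \<le> norm (\<phi> (?z (Suc i) u) - \<phi> (?z i u) - T)
          + norm (\<phi> (?z (Suc i) y) - \<phi> (?z (Suc i) u)) + norm (\<phi> (?z i y) - \<phi> (?z i u))"
        by (meson add_right_mono norm_triangle_ineq norm_triangle_ineq4 order_trans)
      also have "\<dots> \<le> \<eta> * w"
        using T'[OF u(1)] close[of i] close[of "Suc i"] i by linarith
      finally show ?thesis .
    qed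
    let ?a = "?z i 0" and ?d = "w *\<^sub>R (axis 1 1 :: real^2)"
    have cells: "cell p w i = cbox ?a (?a + w *\<^sub>R 1)"
        "cell p w (Suc i) = cbox (?a + ?d) (?a + ?d + w *\<^sub>R 1)"
      by (simp_all add: cell_def grid_point_Suc)
    have sub: "cell p w i \<subseteq> unit_square" "cell p w (Suc i) \<subseteq> unit_square"
      using i by (intro cell_subset_unit_square[OF _ w p]; simp)+
    have ee: "0 < \<eta> * w" "\<eta> * w < \<tau> * w / L"
      using \<eta> w L by (auto simp: field_simps)
    have "integral (cell p w i) \<rho> \<le> integral (cell p w (Suc i)) \<rho> + 4 * C * \<tau> * w\<^sup>2"
      unfolding cells
      by (rule integral_square_le_of_near_translation[OF L \<phi> \<rho> w \<tau>(1,2) _ _ _ _ ee])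
        (use C sub near in \<open>auto simp: cells\<close>)
    \<comment> \<open>The same comparison from the neighbour back, with displacement
      \<open>- ?d\<close> and translation \<open>- T\<close>.\<close>
    moreover have "integral (cbox (?a + ?d) (?a + ?d + w *\<^sub>R 1)) \<rho>
        \<le> integral (cbox (?a + ?d + - ?d) (?a + ?d + - ?d + w *\<^sub>R 1)) \<rho> + 4 * C * \<tau> * w\<^sup>2"
    proof (rule integral_square_le_of_near_translation[OF L \<phi> \<rho> w \<tau>(1,2) _ _ _ _ ee])
      fix x assume "x \<in> cbox (?a + ?d) (?a + ?d + w *\<^sub>R 1)"
      then have "x + - ?d \<in> cell p w i"
        by (auto simp: cells mem_box_cart algebra_simps)
      from near[OF this] show "norm (\<phi> (x + - ?d) - \<phi> x - (- T)) \<le> \<eta> * w"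
        by (simp add: norm_minus_commute algebra_simps)
    qed (use C sub in \<open>auto simp: cells\<close>)
    moreover have "4 * C * \<tau> * w\<^sup>2 \<le> c * w\<^sup>2"
      using \<tau>(3) by (simp add: mult_right_mono)
    ultimately have "\<bar>integral (cell p w i) \<rho> - integral (cell p w (Suc i)) \<rho>\<bar> \<le> c * w\<^sup>2"
      unfolding cells by simp
    then show "\<exists>i<N. \<bar>integral (cell p w i) \<rho> - integral (cell p w (Suc i)) \<rho>\<bar> \<le> c * w\<^sup>2"
      using i by blast
  qed
qed

section \<open>Densities oscillating along a thin strip\<close>

lemma sin_ge_half:
  assumes "pi / 6 \<le> x" "x \<le> 5 * pi / 6"
  shows "1 / 2 \<le> sin x"
proof (cases "x \<le> pi / 2")
  case True
  then have "sin (pi / 6) \<le> sin x"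
    using assms by (intro sin_monotone_2pi_le) auto
  then show ?thesis
    by (simp add: sin_30)
next
  case False
  then have "sin (pi / 6) \<le> sin (pi - x)"
    using assms by (intro sin_monotone_2pi_le) auto
  then show ?thesis
    by (simp add: sin_30)
qed

text \<open>A crude version of the exact value \<open>2 * w\<^sup>2 / pi\<close>: the sine is at
  least \<open>1 / 2\<close> on the middle two thirds of the square and nonnegative on the
  rest.\<close>

lemma integral_sin_square_ge:
  fixes p :: "real^2"
  assumes w: "0 < w"
  shows "w\<^sup>2 / 3 \<le> integral (cbox p (p + w *\<^sub>R 1)) (\<lambda>x. sin (pi * (x $ 1 - p $ 1) / w))"
proof -
  let ?S = "cbox p (p + w *\<^sub>R 1)" and ?f = "\<lambda>x :: real^2. sin (pi * (x $ 1 - p $ 1) / w)"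
  let ?B = "cbox (p + vector [w / 6, 0]) (p + vector [5 * w / 6, w])"
  have int: "?f integrable_on cbox a b" for a b
    using w by (intro integrable_continuous continuous_intros) auto
  have sub: "?B \<subseteq> ?S"
    using w by (auto simp: mem_box_cart forall_2)
  have "?B \<noteq> {}"
    using w by (simp add: interval_ne_empty_cart forall_2)
  then have "measure lborel ?B = w * (w * 2 / 3)"
    by (simp add: content_cbox_cart UNIV_2)
  then have "w\<^sup>2 / 3 = integral ?B (\<lambda>x. 1 / 2)"
    by (simp add: power2_eq_square)
  also have "\<dots> \<le> integral ?B ?f"
  proof (rule integral_le)
    fix x assume "x \<in> ?B"
    then have "w / 6 \<le> x $ 1 - p $ 1" "x $ 1 - p $ 1 \<le> 5 * w / 6"
      by (auto simp: mem_box_cart forall_2)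
    then have "pi * (w / 6) \<le> pi * (x $ 1 - p $ 1)" "pi * (x $ 1 - p $ 1) \<le> pi * (5 * w / 6)"
      by (auto intro!: mult_left_mono)
    then show "1 / 2 \<le> ?f x"
      using w by (intro sin_ge_half) (simp_all add: field_simps)
  qed (use int in auto)
  also have "\<dots> \<le> integral ?S ?f"
  proof (rule integral_subset_le[OF sub int int])
    show "\<forall>x\<in>?S. 0 \<le> ?f x"
    proof
      fix x assume "x \<in> ?S"
      then have "0 \<le> x $ 1 - p $ 1" "x $ 1 - p $ 1 \<le> w"
        by (auto simp: mem_box_cart forall_2)
      then have "0 \<le> pi * (x $ 1 - p $ 1)" "pi * (x $ 1 - p $ 1) \<le> pi * w"
        by (auto intro!: mult_left_mono)
      then show "0 \<le> ?f x"
        using w by (intro sin_ge_zero) (simp_all add: field_simps)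
    qed
  qed
  finally show ?thesis .
qed

lemma integral_cell:
  "integral (cell p w i) f = integral (cbox p (p + w *\<^sub>R 1)) (\<lambda>x. f (x + (w * real i) *\<^sub>R axis 1 1))"
  using integral_shift_cbox_plus[of p "p + w *\<^sub>R 1" f "(w * real i) *\<^sub>R axis 1 1"]
  by (simp add: cell_def grid_point_def o_def algebra_simps)

text \<open>Comparison with the constant \<open>b\<close> on a box of width \<open>1\<close> and
  height \<open>2 * h\<close>. The box may stick out of the unit square, so both integrands are
  extended by zero to the plane.\<close>

lemma integral_strip_le:
  fixes f :: "real^2 \<Rightarrow> real"
  assumes f: "f integrable_on unit_square" and "0 \<le> b" "0 \<le> h"
    and le: "\<And>x. x \<in> unit_square \<Longrightarrow> f x \<le> b"
    and out: "\<And>x. \<lbrakk>x \<in> unit_square; h < \<bar>x $ 2 - y\<bar>\<rbrakk> \<Longrightarrow> f x \<le> 0"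
  shows "integral unit_square f \<le> 2 * b * h"
proof -
  let ?B = "cbox (vector [0, y - h]) (vector [1, y + h]) :: (real^2) set"
  have "integral unit_square f = integral UNIV (\<lambda>x. if x \<in> unit_square then f x else 0)"
    by (simp add: integral_restrict_UNIV)
  also have "\<dots> \<le> integral UNIV (\<lambda>x. if x \<in> ?B then b else 0)"
  proof (rule integral_le)
    show "(\<lambda>x. if x \<in> unit_square then f x else 0) integrable_on UNIV"
      using f by (simp add: integrable_restrict_UNIV)
    show "(\<lambda>x. if x \<in> ?B then b else 0) integrable_on UNIV"
      by (subst integrable_restrict_UNIV) (rule integrable_const)
    fix x :: "real^2"
    have "h < \<bar>x $ 2 - y\<bar>" if "x \<in> unit_square" "x \<notin> ?B"
      using that by (auto simp: unit_square_def mem_box_cart forall_2)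
    then show "(if x \<in> unit_square then f x else 0) \<le> (if x \<in> ?B then b else 0)"
      using le[of x] out[of x] \<open>0 \<le> b\<close> by auto
  qed
  also have "\<dots> = measure lborel ?B * b"
    by (subst integral_restrict_UNIV) simp
  also have "measure lborel ?B = 2 * h"
    using \<open>0 \<le> h\<close> by (subst content_cbox_cart) (auto simp: interval_ne_empty_cart forall_2 UNIV_2)
  finally show ?thesis
    by (simp add: mult_ac)
qed

text \<open>Near the segment, \<rho>1 is replaced by \<rho>0 plus a sine wave of amplitude
  \<epsilon>, and a cutoff blends this back into \<rho>1. Oscillating around \<rho>0 instead of
  adding to \<rho>1 preserves the supremum bound under repetition; the thinness of the strip makes
  the change small in mean.\<close>

lemma oscillating_strip_perturbation:
  fixes p :: "real^2"
  assumes \<rho>0: "continuous_on unit_square \<rho>0" and \<rho>1: "continuous_on unit_square \<rho>1"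
    and close: "\<And>x. x \<in> unit_square \<Longrightarrow> \<bar>\<rho>1 x - \<rho>0 x\<bar> \<le> \<epsilon>" and \<epsilon>: "0 < \<epsilon>" and \<delta>: "0 < \<delta>"
    and p: "0 < l" "0 \<le> p $ 1" "p $ 1 + l \<le> 1" "0 \<le> p $ 2" "p $ 2 < 1"
  obtains N w \<rho>2 where "N0 \<le> N" "0 < w" "(real N + 1) * w = l" "p $ 2 + w < 1"
    "continuous_on unit_square \<rho>2" "\<forall>x\<in>unit_square. \<bar>\<rho>2 x - \<rho>0 x\<bar> \<le> \<epsilon>"
    "integral unit_square (\<lambda>x. \<bar>\<rho>2 x - \<rho>1 x\<bar>) < \<delta>"
    "\<forall>i<N. \<epsilon> / 2 * w\<^sup>2 \<le> \<bar>integral (cell p w i) \<rho>2 - integral (cell p w (Suc i)) \<rho>2\<bar>"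
proof -
  have "uniformly_continuous_on unit_square \<rho>0"
    using \<rho>0 by (intro compact_uniformly_continuous) (auto simp: unit_square_eq_cbox)
  then obtain r where r: "0 < r"
    and unif: "\<And>x y. \<lbrakk>x \<in> unit_square; y \<in> unit_square; dist y x < r\<rbrakk> \<Longrightarrow> dist (\<rho>0 y) (\<rho>0 x) < \<epsilon> / 6"
    unfolding uniformly_continuous_on_def using \<epsilon> by (metis zero_less_divide_iff zero_less_numeral)
  \<comment> \<open>An upper bound for the side \<open>w\<close>: \<open>r\<close> controls \<rho>0
    between neighbouring squares, \<open>1 - p $ 2\<close> keeps the row inside the unit square, and
    the last term makes the integral of the change less than \<delta>.\<close>
  define m where "m = min r (min (1 - p $ 2) (\<delta> / (8 * \<epsilon>)))"
  have "0 < m" "m \<le> r" "m \<le> 1 - p $ 2" "m \<le> \<delta> / (8 * \<epsilon>)"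
    using r p \<epsilon> \<delta> by (auto simp: m_def)
  then have m: "0 < m" "m \<le> r" "m \<le> 1 - p $ 2" "8 * \<epsilon> * m \<le> \<delta>"
    using \<epsilon> by (auto simp: field_simps)
  obtain N1 :: nat where N1: "l / m < N1"
    using reals_Archimedean2 by blast
  define N where "N = max N0 N1"
  define w where "w = l / (real N + 1)"
  have w: "0 < w" "(real N + 1) * w = l"
    using p by (auto simp: w_def)
  have "l < m * real N1"
    using N1 m(1) by (simp add: field_simps)
  also have "\<dots> \<le> m * (real N + 1)"
    using m(1) by (intro mult_left_mono) (auto simp: N_def)
  finally have wm: "w < m"
    by (simp add: w_def field_simps add_pos_nonneg)
  \<comment> \<open>The half-period is \<open>w\<close>, so a shift by one square reverses the
    sign.\<close>
  define s where "s x = sin (pi * (x $ 1 - p $ 1) / w)" for x :: "real^2"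
  \<comment> \<open>A continuous cutoff: \<open>1\<close> up to vertical distance \<open>w\<close>
    from the segment, hence on all squares of the row, and \<open>0\<close> from distance
    \<open>2 * w\<close> on.\<close>
  define \<kappa> where "\<kappa> x = max 0 (min 1 (2 - \<bar>x $ 2 - p $ 2\<bar> / w))" for x :: "real^2"
  define \<rho>2 where "\<rho>2 x = \<rho>1 x + \<kappa> x * (\<rho>0 x + \<epsilon> * s x - \<rho>1 x)" for x
  have cont2: "continuous_on unit_square \<rho>2"
    unfolding \<rho>2_def \<kappa>_def s_def using w by (intro continuous_intros \<rho>0 \<rho>1) auto
  have \<kappa>: "0 \<le> \<kappa> x" "\<kappa> x \<le> 1" for x
    by (auto simp: \<kappa>_def)
  have s1: "\<bar>\<epsilon> * s x\<bar> \<le> \<epsilon>" for x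
    using \<epsilon> by (simp add: abs_mult s_def mult_le_cancel_left1)
  have close2: "\<bar>\<rho>2 x - \<rho>0 x\<bar> \<le> \<epsilon>" if "x \<in> unit_square" for x
  proof -
    \<comment> \<open>A convex combination of two deviations, each at most \<epsilon> in absolute
      value.\<close>
    have "\<rho>2 x - \<rho>0 x = (1 - \<kappa> x) * (\<rho>1 x - \<rho>0 x) + \<kappa> x * (\<epsilon> * s x)"
      by (simp add: \<rho>2_def algebra_simps)
    also have "\<bar>\<dots>\<bar> \<le> (1 - \<kappa> x) * \<bar>\<rho>1 x - \<rho>0 x\<bar> + \<kappa> x * \<bar>\<epsilon> * s x\<bar>"
      using \<kappa>[of x] by (metis abs_mult abs_of_nonneg abs_triangle_ineq diff_ge_0_iff_ge)
    also have "\<dots> \<le> (1 - \<kappa> x) * \<epsilon> + \<kappa> x * \<epsilon>"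
      using \<kappa>[of x] close[OF that] s1[of x] by (intro add_mono mult_left_mono) auto
    finally show ?thesis
      by (simp add: algebra_simps)
  qed
  have "integral unit_square (\<lambda>x. \<bar>\<rho>2 x - \<rho>1 x\<bar>) \<le> 2 * (2 * \<epsilon>) * (2 * w)"
  proof (rule integral_strip_le)
    have "continuous_on unit_square (\<lambda>x. \<bar>\<rho>2 x - \<rho>1 x\<bar>)"
      by (intro continuous_intros cont2 \<rho>1)
    then show "(\<lambda>x. \<bar>\<rho>2 x - \<rho>1 x\<bar>) integrable_on unit_square"
      unfolding unit_square_eq_cbox by (rule integrable_continuous)
    show "\<bar>\<rho>2 x - \<rho>1 x\<bar> \<le> 2 * \<epsilon>" if "x \<in> unit_square" for x
      using close[OF that] close2[OF that] by linarith
    show "\<bar>\<rho>2 x - \<rho>1 x\<bar> \<le> 0" if "2 * w < \<bar>x $ 2 - p $ 2\<bar>" for x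
      using that w by (simp add: \<rho>2_def \<kappa>_def field_simps)
  qed (use \<epsilon> w in auto)
  also have "\<dots> < 8 * \<epsilon> * m"
    using wm \<epsilon> by simp
  finally have L1: "integral unit_square (\<lambda>x. \<bar>\<rho>2 x - \<rho>1 x\<bar>) < \<delta>"
    using m(4) by simp
  have osc: "\<epsilon> / 2 * w\<^sup>2 \<le> \<bar>integral (cell p w i) \<rho>2 - integral (cell p w (Suc i)) \<rho>2\<bar>" if i: "i < N" for i
  proof -
    let ?S = "cbox p (p + w *\<^sub>R 1)"
    define c where "c j = (w * real j) *\<^sub>R (axis 1 1 :: real^2)" for j
    have inQ: "x + c j \<in> unit_square" if "x \<in> ?S" "j \<le> N" for x j
    proof -
      have "x + c j \<in> cell p w j"
        using that(1) by (auto simp: c_def cell_def grid_point_def mem_box_cart algebra_simps)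
      then show ?thesis
        using cell_subset_unit_square[OF that(2) w(1) p(2) _ p(4)] w(2) p(3) wm m(3) by auto
    qed
    have sin_shift: "s (x + c j) = (-1) ^ j * s x" for x j
    proof -
      have "pi * ((x + c j) $ 1 - p $ 1) / w = pi * (x $ 1 - p $ 1) / w + real j * pi"
        using w by (simp add: c_def axis_def field_simps)
      then show ?thesis
        by (simp add: s_def sin_add)
    qed
    have \<rho>2_cell: "\<rho>2 (x + c j) = \<rho>0 (x + c j) + (\<epsilon> * (-1) ^ j) * s x" if "x \<in> ?S" for x j
    proof -
      have "\<bar>(x + c j) $ 2 - p $ 2\<bar> \<le> w"
        using that w by (auto simp: c_def axis_def mem_box_cart forall_2 abs_le_iff)
      then have "\<kappa> (x + c j) = 1"
        using w by (simp add: \<kappa>_def field_simps)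
      then show ?thesis
        by (simp add: \<rho>2_def sin_shift)
    qed
    have ints: "s integrable_on ?S"
      unfolding s_def using w by (intro integrable_continuous continuous_intros) auto
    have int0: "(\<lambda>x. \<rho>0 (x + c j)) integrable_on ?S" if "j \<le> N" for j
      using inQ[OF _ that] by (intro integrable_continuous continuous_on_compose2[OF \<rho>0])
        (auto intro!: continuous_intros)
    have cell: "integral (cell p w j) \<rho>2 = integral ?S (\<lambda>x. \<rho>0 (x + c j)) + (\<epsilon> * (-1) ^ j) * integral ?S s"
      if "j \<le> N" for j
    proof -
      have "integral (cell p w j) \<rho>2 = integral ?S (\<lambda>x. \<rho>0 (x + c j) + (\<epsilon> * (-1) ^ j) * s x)"
        unfolding integral_cell c_def[symmetric]
        by (rule Henstock_Kurzweil_Integration.integral_cong) (rule \<rho>2_cell)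
      also have "\<dots> = integral ?S (\<lambda>x. \<rho>0 (x + c j)) + integral ?S (\<lambda>x. (\<epsilon> * (-1) ^ j) * s x)"
        using int0[OF that] ints
        by (intro Henstock_Kurzweil_Integration.integral_add) (auto intro: integrable_on_mult_right)
      finally show ?thesis
        by simp
    qed
    let ?d = "\<lambda>x. \<rho>0 (x + c i) - \<rho>0 (x + c (Suc i))"
    have "norm (integral ?S ?d) \<le> (\<epsilon> / 6) * measure lborel ?S"
    proof (rule integrable_bound)
      show "?d integrable_on ?S"
        using int0[of i] int0[of "Suc i"] i by (intro integrable_diff) auto
      fix x assume x: "x \<in> ?S"
      have "x + c (Suc i) - (x + c i) = w *\<^sub>R axis 1 1"
        by (simp add: c_def algebra_simps)
      then have "dist (x + c (Suc i)) (x + c i) < r"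
        using wm m(2) w(1) unfolding dist_norm by (simp add: norm_axis_1)
      then have "dist (\<rho>0 (x + c (Suc i))) (\<rho>0 (x + c i)) < \<epsilon> / 6"
        using unif inQ[OF x] i by simp
      then show "norm (?d x) \<le> \<epsilon> / 6"
        by (simp add: dist_real_def abs_minus_commute)
    qed (use \<epsilon> in auto)
    also have "measure lborel ?S = w\<^sup>2"
      using w by (subst content_cbox_cart) (auto simp: interval_eq_empty_cart UNIV_2 power2_eq_square)
    finally have small: "\<bar>integral ?S ?d\<bar> \<le> \<epsilon> / 6 * w\<^sup>2"
      by simp
    \<comment> \<open>The sine terms of neighbouring squares have opposite signs and reinforce each
      other to at least \<open>2 * \<epsilon> * (w\<^sup>2 / 3)\<close>. The variation of \<rho>0
      takes away at most \<open>\<epsilon> / 6 * w\<^sup>2\<close>, which leaves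
      \<open>\<epsilon> / 2 * w\<^sup>2\<close>.\<close>
    have eq: "integral (cell p w i) \<rho>2 - integral (cell p w (Suc i)) \<rho>2
        = integral ?S ?d + (-1) ^ i * (2 * \<epsilon> * integral ?S s)"
      using cell[of i] cell[of "Suc i"] int0[of i] int0[of "Suc i"] i
      by (simp add: Henstock_Kurzweil_Integration.integral_diff algebra_simps)
    have "w\<^sup>2 / 3 \<le> integral ?S s"
      unfolding s_def by (rule integral_sin_square_ge[OF w(1)])
    then have "2 * \<epsilon> * (w\<^sup>2 / 3) \<le> 2 * \<epsilon> * integral ?S s"
      using \<epsilon> by (intro mult_left_mono) auto
    have "2 * \<epsilon> * (w\<^sup>2 / 3) \<le> \<bar>(-1) ^ i * (2 * \<epsilon> * integral ?S s)\<bar>"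
    proof -
      have "\<bar>(-1) ^ i * y\<bar> = \<bar>y\<bar>" for y :: real
        by (simp add: abs_mult)
      then have "\<bar>(-1) ^ i * (2 * \<epsilon> * integral ?S s)\<bar> = \<bar>2 * \<epsilon> * integral ?S s\<bar>"
        by blast
      then show ?thesis
        using \<open>2 * \<epsilon> * (w\<^sup>2 / 3) \<le> 2 * \<epsilon> * integral ?S s\<close> by linarith
    qed
    then show ?thesis
      unfolding eq using small by linarith
  qed
  show thesis
    by (rule that[of N w \<rho>2]) (use w wm m cont2 close2 L1 osc in \<open>auto simp: N_def\<close>)
qed

section \<open>Repeated amplification of the stretching\<close>

text \<open>The pair \<open>(p, l)\<close> stands for the horizontal segment from \<open>p\<close> to \<open>p + l *\<^sub>R axis 1 1\<close>.\<close>

definition segments :: "((real^2) \<times> real) set" where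
  "segments = {(p, l). 0 < l \<and> 0 \<le> p $ 1 \<and> p $ 1 + l \<le> 1 \<and> 0 \<le> p $ 2 \<and> p $ 2 < 1}"

definition stretched :: "(real^2 \<Rightarrow> real^2) \<Rightarrow> real \<Rightarrow> (real^2) \<times> real \<Rightarrow> bool" where
  "stretched \<phi> A = (\<lambda>(p, l). A * l \<le> dist (\<phi> p) (\<phi> (p + l *\<^sub>R axis 1 1)))"

text \<open>The bound \<open>C\<close> is carried along because \<open>rigidity\<close> asks for a
  pointwise upper bound, which closeness in mean does not give.\<close>

definition transports_near ::
    "real \<Rightarrow> real \<Rightarrow> (real^2 \<Rightarrow> real) \<Rightarrow> real \<Rightarrow> (real^2 \<Rightarrow> real) \<Rightarrow> (real^2 \<Rightarrow> real^2) \<Rightarrow> bool" where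
  "transports_near L C \<rho>0 \<delta> \<rho> \<phi> \<longleftrightarrow>
     transports L \<rho> \<phi> \<and> continuous_on unit_square \<rho> \<and> (\<forall>x\<in>unit_square. \<rho> x \<le> C) \<and>
     integral unit_square (\<lambda>x. \<bar>\<rho> x - \<rho>0 x\<bar>) < \<delta>"

lemma segments_endpoints:
  assumes "(p, l) \<in> segments"
  shows "p \<in> unit_square" "p + l *\<^sub>R axis 1 1 \<in> unit_square"
  using assms by (auto simp: segments_def unit_square_def forall_2 axis_def)

lemma transports_near_trans:
  assumes near: "transports_near L C \<rho>2 \<delta>2 \<rho> \<phi>"
    and cont: "continuous_on unit_square \<rho>1" "continuous_on unit_square \<rho>2"
    and "integral unit_square (\<lambda>x. \<bar>\<rho>2 x - \<rho>1 x\<bar>) + \<delta>2 \<le> \<delta>1"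
  shows "transports_near L C \<rho>1 \<delta>1 \<rho> \<phi>"
proof -
  have \<rho>: "continuous_on unit_square \<rho>"
    using near by (simp add: transports_near_def)
  have int: "(\<lambda>x. \<bar>f x - g x\<bar>) integrable_on unit_square"
    if "continuous_on unit_square f" "continuous_on unit_square g" for f g :: "real^2 \<Rightarrow> real"
    using that unfolding unit_square_eq_cbox by (intro integrable_continuous continuous_intros)
  have "integral unit_square (\<lambda>x. \<bar>\<rho> x - \<rho>1 x\<bar>)
      \<le> integral unit_square (\<lambda>x. \<bar>\<rho> x - \<rho>2 x\<bar> + \<bar>\<rho>2 x - \<rho>1 x\<bar>)"
    using int \<rho> cont by (intro integral_le integrable_add) auto
  also have "\<dots> = integral unit_square (\<lambda>x. \<bar>\<rho> x - \<rho>2 x\<bar>) + integral unit_square (\<lambda>x. \<bar>\<rho>2 x - \<rho>1 x\<bar>)"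
    using int \<rho> cont by (intro Henstock_Kurzweil_Integration.integral_add) auto
  finally show ?thesis
    using near assms(4) by (simp add: transports_near_def)
qed

lemma abs_integral_diff_le_L1:
  assumes "continuous_on unit_square f" "continuous_on unit_square g" "cbox a b \<subseteq> unit_square"
  shows "\<bar>integral (cbox a b) f - integral (cbox a b) g\<bar>
    \<le> integral unit_square (\<lambda>x. \<bar>f x - g x\<bar> :: real)"
proof -
  have cont: "continuous_on unit_square (\<lambda>x. f x - g x)" "continuous_on unit_square (\<lambda>x. \<bar>f x - g x\<bar>)"
    using assms by (auto intro!: continuous_intros)
  have int: "h integrable_on cbox a b" if "continuous_on unit_square h" for h :: "real^2 \<Rightarrow> real"
    by (intro integrable_continuous continuous_on_subset[OF that assms(3)])
  have "integral (cbox a b) f - integral (cbox a b) g = integral (cbox a b) (\<lambda>x. f x - g x)"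
    using int assms by (simp add: Henstock_Kurzweil_Integration.integral_diff)
  also have "norm \<dots> \<le> integral (cbox a b) (\<lambda>x. \<bar>f x - g x\<bar>)"
    using int[OF cont(1)] int[OF cont(2)] by (intro integral_norm_bound_integral) auto
  also have "\<dots> \<le> integral unit_square (\<lambda>x. \<bar>f x - g x\<bar>)"
    using int[OF cont(2)] cont(2) assms(3)
    by (intro integral_subset_le) (auto simp: unit_square_eq_cbox intro: integrable_continuous)
  finally show ?thesis
    by simp
qed

text \<open>
  The new density is close to \<open>\<rho>1\<close> only in \<open>L\<^sup>1\<close>, since it is reset to an oscillation around
  \<open>\<rho>0\<close> on a thin strip; this is why the induction works with \<open>L\<^sup>1\<close>-neighbourhoods, while
  the supremum distance to \<open>\<rho>0\<close> stays at most \<open>\<epsilon>\<close> throughout.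
\<close>

lemma perturb_to_amplify_stretching:
  fixes L C \<epsilon> :: real
  assumes L: "1 \<le> L" and C: "0 < C" and \<epsilon>: "0 < \<epsilon>" and \<rho>0: "continuous_on unit_square \<rho>0"
  obtains k where "0 < k"
    "\<And>\<rho>1 \<delta>1 q A. \<lbrakk>continuous_on unit_square \<rho>1; \<And>x. x \<in> unit_square \<Longrightarrow> \<bar>\<rho>1 x - \<rho>0 x\<bar> \<le> \<epsilon>;
        0 < \<delta>1; q \<in> segments; 0 < A\<rbrakk>
      \<Longrightarrow> \<exists>\<rho>2 \<delta>2 P. continuous_on unit_square \<rho>2 \<and> (\<forall>x\<in>unit_square. \<bar>\<rho>2 x - \<rho>0 x\<bar> \<le> \<epsilon>) \<and>
          0 < \<delta>2 \<and> finite P \<and> P \<subseteq> segments \<and>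
          (\<forall>\<rho> \<phi>. transports_near L C \<rho>2 \<delta>2 \<rho> \<phi> \<longrightarrow> transports_near L C \<rho>1 \<delta>1 \<rho> \<phi> \<and>
             (stretched \<phi> A q \<longrightarrow> (\<exists>q'\<in>P. stretched \<phi> ((1 + k) * A) q')))"
proof -
  have \<epsilon>4: "0 < \<epsilon> / 4"
    using \<epsilon> by simp
  show thesis
  proof (rule rigidity[OF L \<epsilon>4 C])
    fix G k N0
    assume G: "finite G" "G \<subseteq> unit_square" and k: "0 < k"
    and rigid: "\<And>N w p A \<rho> \<phi>.
      \<lbrakk>N0 \<le> N; 0 < w; 0 \<le> p $ 1; p $ 1 + (real N + 1) * w \<le> 1; 0 \<le> p $ 2; p $ 2 + w \<le> 1;
       transports L \<rho> \<phi>; continuous_on unit_square \<rho>; \<And>x. x \<in> unit_square \<Longrightarrow> \<rho> x \<le> C;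
       0 < A; A * ((real N + 1) * w) \<le> dist (\<phi> p) (\<phi> (p + ((real N + 1) * w) *\<^sub>R axis 1 1));
       \<And>i u. \<lbrakk>i < N; u \<in> G\<rbrakk> \<Longrightarrow>
         dist (\<phi> (grid_point p w i u)) (\<phi> (grid_point p w (Suc i) u)) \<le> (1 + k) * A * w\<rbrakk>
      \<Longrightarrow> \<exists>i<N. \<bar>integral (cell p w i) \<rho> - integral (cell p w (Suc i)) \<rho>\<bar> \<le> \<epsilon> / 4 * w\<^sup>2"
    show thesis
    proof (rule that[OF k])
      fix \<rho>1 \<delta>1 q A
      assume \<rho>1: "continuous_on unit_square \<rho>1" "\<And>x. x \<in> unit_square \<Longrightarrow> \<bar>\<rho>1 x - \<rho>0 x\<bar> \<le> \<epsilon>"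
        and \<delta>1: "0 < (\<delta>1 :: real)" and q: "q \<in> segments" and A: "0 < (A :: real)"
      obtain p l where q_eq: "q = (p, l)"
        by (cases q)
      have p: "0 < l" "0 \<le> p $ 1" "p $ 1 + l \<le> 1" "0 \<le> p $ 2" "p $ 2 < 1"
        using q by (auto simp: q_eq segments_def)
      have \<delta>half: "0 < \<delta>1 / 2"
        using \<delta>1 by simp
      obtain N w \<rho>2 where N: "N0 \<le> N" and w: "0 < w" "(real N + 1) * w = l" "p $ 2 + w < 1"
        and \<rho>2: "continuous_on unit_square \<rho>2" "\<forall>x\<in>unit_square. \<bar>\<rho>2 x - \<rho>0 x\<bar> \<le> \<epsilon>"
        and L1: "integral unit_square (\<lambda>x. \<bar>\<rho>2 x - \<rho>1 x\<bar>) < \<delta>1 / 2"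
        and osc: "\<forall>i<N. \<epsilon> / 2 * w\<^sup>2 \<le> \<bar>integral (cell p w i) \<rho>2 - integral (cell p w (Suc i)) \<rho>2\<bar>"
      proof (rule oscillating_strip_perturbation[OF \<rho>0 \<rho>1 \<epsilon> \<delta>half p, where ?N0.0 = N0])
      qed auto
      have strip: "p $ 1 + (real N + 1) * w \<le> 1" "p $ 2 + w \<le> 1"
        using p w by simp_all
      \<comment> \<open>The first term keeps the new neighbourhood inside the old one. The second
        lets each of two cell integrals move by less than \<open>\<epsilon> / 8 * w\<^sup>2\<close>,
        so that the oscillation \<open>\<epsilon> / 2 * w\<^sup>2\<close> stays above the bound
        \<open>\<epsilon> / 4 * w\<^sup>2\<close> from \<open>rigid\<close>.\<close>
      define \<delta>2 where "\<delta>2 = min (\<delta>1 / 2) (\<epsilon> / 8 * w\<^sup>2)"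
      \<comment> \<open>All the steps that \<open>rigid\<close> inspects. The set is finite and
        chosen before \<rho> and \<phi>.\<close>
      define P where "P = (\<lambda>(i, u). (grid_point p w i u, w)) ` ({..<N} \<times> G)"
      have "(grid_point p w i u, w) \<in> segments" if "i < N" "u \<in> G" for i u
      proof -
        have "grid_point p w i u \<in> unit_square" "grid_point p w (Suc i) u \<in> unit_square"
          using that G(2) by (auto intro!: grid_point_in_unit_square[OF _ w(1) _ p(2) strip(1) p(4) strip(2)])
        moreover have "u $ 2 \<le> 1"
          using that(2) G(2) by (auto simp: unit_square_def)
        then have "w * u $ 2 \<le> w"
          using w(1) by simp
        \<comment> \<open>The strict inequality leaves room for another strip above the new segment
          in the next round.\<close>
        then have "grid_point p w i u $ 2 < 1"
          using w(3) by (simp add: grid_point_def axis_def)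
        ultimately show ?thesis
          using w(1) by (auto simp: segments_def unit_square_def grid_point_Suc axis_def forall_2)
      qed
      then have P: "finite P" "P \<subseteq> segments"
        using G(1) by (auto simp: P_def)
      have "transports_near L C \<rho>1 \<delta>1 \<rho> \<phi> \<and> (stretched \<phi> A q \<longrightarrow> (\<exists>q'\<in>P. stretched \<phi> ((1 + k) * A) q'))"
        if near: "transports_near L C \<rho>2 \<delta>2 \<rho> \<phi>" for \<rho> \<phi>
      proof (intro conjI impI)
        show "transports_near L C \<rho>1 \<delta>1 \<rho> \<phi>"
          by (rule transports_near_trans[OF near \<rho>1(1) \<rho>2(1)]) (use L1 in \<open>simp add: \<delta>2_def\<close>)
        assume st: "stretched \<phi> A q"
        have \<rho>: "transports L \<rho> \<phi>" "continuous_on unit_square \<rho>" "\<And>x. x \<in> unit_square \<Longrightarrow> \<rho> x \<le> C"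
          and small: "integral unit_square (\<lambda>x. \<bar>\<rho> x - \<rho>2 x\<bar>) < \<epsilon> / 8 * w\<^sup>2"
          using near by (auto simp: transports_near_def \<delta>2_def)
        show "\<exists>q'\<in>P. stretched \<phi> ((1 + k) * A) q'"
        proof (rule ccontr)
          assume none: "\<not> ?thesis"
          have "\<exists>i<N. \<bar>integral (cell p w i) \<rho> - integral (cell p w (Suc i)) \<rho>\<bar> \<le> \<epsilon> / 4 * w\<^sup>2"
          proof (rule rigid[OF N w(1) p(2) strip(1) p(4) strip(2) \<rho> A])
            show "A * ((real N + 1) * w) \<le> dist (\<phi> p) (\<phi> (p + ((real N + 1) * w) *\<^sub>R axis 1 1))"
              using st unfolding w(2) by (simp add: stretched_def q_eq)
            fix i u assume "i < N" "u \<in> G"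
            then have "(grid_point p w i u, w) \<in> P"
              by (auto simp: P_def)
            then show "dist (\<phi> (grid_point p w i u)) (\<phi> (grid_point p w (Suc i) u)) \<le> (1 + k) * A * w"
              using none by (force simp: stretched_def grid_point_Suc)
          qed
          then obtain i where i: "i < N"
            and le: "\<bar>integral (cell p w i) \<rho> - integral (cell p w (Suc i)) \<rho>\<bar> \<le> \<epsilon> / 4 * w\<^sup>2"
            by blast
          have "\<bar>integral (cell p w j) \<rho> - integral (cell p w j) \<rho>2\<bar> < \<epsilon> / 8 * w\<^sup>2" if "j \<le> N" for j
          proof -
            have "cell p w j \<subseteq> unit_square"
              by (rule cell_subset_unit_square[OF that w(1) p(2) strip(1) p(4) strip(2)])
            then show ?thesis
              using abs_integral_diff_le_L1[OF \<rho>(2) \<rho>2(1)] small unfolding cell_def by (meson order_le_less_trans)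
          qed
          from this[of i] this[of "Suc i"] show False
            using osc[rule_format, OF i] le i by linarith
        qed
      qed
      moreover have "0 < \<delta>2"
        using \<delta>1 \<epsilon> w(1) by (simp add: \<delta>2_def)
      ultimately show "\<exists>\<rho>2 \<delta>2 P. continuous_on unit_square \<rho>2 \<and> (\<forall>x\<in>unit_square. \<bar>\<rho>2 x - \<rho>0 x\<bar> \<le> \<epsilon>) \<and>
            0 < \<delta>2 \<and> finite P \<and> P \<subseteq> segments \<and>
            (\<forall>\<rho> \<phi>. transports_near L C \<rho>2 \<delta>2 \<rho> \<phi> \<longrightarrow> transports_near L C \<rho>1 \<delta>1 \<rho> \<phi> \<and>
               (stretched \<phi> A q \<longrightarrow> (\<exists>q'\<in>P. stretched \<phi> ((1 + k) * A) q')))"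
        using \<rho>2 P by (intro exI[of _ \<rho>2] exI[of _ \<delta>2] exI[of _ P]) blast
    qed
  qed
qed

text \<open>The lower Lipschitz bound starts an iteration in which the forced stretching grows by
  the factor \<open>1 + k\<close> per round, until it contradicts the upper Lipschitz bound.\<close>

lemma exists_density_without_near_transports:
  fixes L C \<epsilon> :: real
  assumes L: "1 \<le> L" and C: "0 < C" and \<epsilon>: "0 < \<epsilon>" and \<rho>0: "continuous_on unit_square \<rho>0"
  obtains \<rho>1 \<delta> where "continuous_on unit_square \<rho>1"
    "\<And>x. x \<in> unit_square \<Longrightarrow> \<bar>\<rho>1 x - \<rho>0 x\<bar> \<le> \<epsilon>" "0 < \<delta>"
    "\<And>\<rho> \<phi>. \<not> transports_near L C \<rho>1 \<delta> \<rho> \<phi>"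
proof -
  define good where "good \<rho>1 \<delta> P \<longleftrightarrow> continuous_on unit_square \<rho>1 \<and>
      (\<forall>x\<in>unit_square. \<bar>\<rho>1 x - \<rho>0 x\<bar> \<le> \<epsilon>) \<and> 0 < \<delta> \<and> finite P \<and> P \<subseteq> segments"
    for \<rho>1 and \<delta> :: real and P :: "((real^2) \<times> real) set"
  show thesis
  proof (rule perturb_to_amplify_stretching[OF assms])
    fix k assume k: "0 < k" and one: "\<And>\<rho>1 \<delta>1 q A.
        \<lbrakk>continuous_on unit_square \<rho>1; \<And>x. x \<in> unit_square \<Longrightarrow> \<bar>\<rho>1 x - \<rho>0 x\<bar> \<le> \<epsilon>; 0 < \<delta>1; q \<in> segments; 0 < A\<rbrakk>
        \<Longrightarrow> \<exists>\<rho>2 \<delta>2 P. continuous_on unit_square \<rho>2 \<and> (\<forall>x\<in>unit_square. \<bar>\<rho>2 x - \<rho>0 x\<bar> \<le> \<epsilon>) \<and>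
            0 < \<delta>2 \<and> finite P \<and> P \<subseteq> segments \<and>
            (\<forall>\<rho> \<phi>. transports_near L C \<rho>2 \<delta>2 \<rho> \<phi> \<longrightarrow> transports_near L C \<rho>1 \<delta>1 \<rho> \<phi> \<and>
               (stretched \<phi> A q \<longrightarrow> (\<exists>q'\<in>P. stretched \<phi> ((1 + k) * A) q')))"
    \<comment> \<open>It is unknown which segment of \<open>P\<close> a given \<phi> stretches, so
      they are treated one after another. What was achieved for earlier segments persists, because
      maps near the new density are also near the previous one.\<close>
    have all: "\<exists>\<rho>2 \<delta>2 P'. good \<rho>2 \<delta>2 P' \<and>
        (\<forall>\<rho> \<phi>. transports_near L C \<rho>2 \<delta>2 \<rho> \<phi> \<longrightarrow> transports_near L C \<rho>1 \<delta>1 \<rho> \<phi> \<and>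
          ((\<exists>q\<in>P. stretched \<phi> A q) \<longrightarrow> (\<exists>q\<in>P'. stretched \<phi> ((1 + k) * A) q)))"
      if "finite P" "good \<rho>1 \<delta>1 P" "0 < A" for P \<rho>1 \<delta>1 A
      using that
    proof (induction P)
      case empty
      then show ?case
        by (intro exI[of _ \<rho>1] exI[of _ \<delta>1] exI[of _ "{}"]) auto
    next
      case (insert q P)
      then have "good \<rho>1 \<delta>1 P" and q: "q \<in> segments"
        by (auto simp: good_def)
      then obtain \<rho>2 \<delta>2 P2 where g2: "good \<rho>2 \<delta>2 P2"
        and near2: "\<And>\<rho> \<phi>. transports_near L C \<rho>2 \<delta>2 \<rho> \<phi> \<Longrightarrow> transports_near L C \<rho>1 \<delta>1 \<rho> \<phi> \<and>
          ((\<exists>q\<in>P. stretched \<phi> A q) \<longrightarrow> (\<exists>q\<in>P2. stretched \<phi> ((1 + k) * A) q))"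
        using insert.IH insert.prems(2) by blast
      obtain \<rho>3 \<delta>3 P3 where g3: "good \<rho>3 \<delta>3 P3"
        and near3: "\<And>\<rho> \<phi>. transports_near L C \<rho>3 \<delta>3 \<rho> \<phi> \<Longrightarrow> transports_near L C \<rho>2 \<delta>2 \<rho> \<phi> \<and>
          (stretched \<phi> A q \<longrightarrow> (\<exists>q'\<in>P3. stretched \<phi> ((1 + k) * A) q'))"
        using one[of \<rho>2 \<delta>2 q A] g2 q insert.prems(2) unfolding good_def by blast
      have "good \<rho>3 \<delta>3 (P2 \<union> P3)"
        using g2 g3 by (auto simp: good_def)
      then show ?case
        using near2 near3 by (intro exI[of _ \<rho>3] exI[of _ \<delta>3] exI[of _ "P2 \<union> P3"]) blast
    qed
    have iter: "\<exists>\<rho>1 \<delta> P. good \<rho>1 \<delta> P \<and>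
        (\<forall>\<rho> \<phi>. transports_near L C \<rho>1 \<delta> \<rho> \<phi> \<longrightarrow> (\<exists>q\<in>P. stretched \<phi> ((1 + k) ^ j / L) q))" for j
    proof (induction j)
      case 0
      \<comment> \<open>The bottom edge of the unit square, stretched by at least
        \<open>1 / L\<close> under every admissible map.\<close>
      have seg: "(0, 1) \<in> segments"
        by (simp add: segments_def)
      have "stretched \<phi> (1 / L) (0, 1)" if "transports_near L C \<rho>0 1 \<rho> \<phi>" for \<rho> \<phi>
      proof -
        have "bi_lipschitz_with L unit_square \<phi>"
          using that by (simp add: transports_near_def transports_def)
        from bi_lipschitz_with_dist_ge[OF this segments_endpoints[OF seg]] show ?thesis
          by (simp add: stretched_def dist_norm norm_axis_1)
      qed
      then show ?case
        using seg \<rho>0 \<epsilon> by (intro exI[of _ \<rho>0] exI[of _ 1] exI[of _ "{(0, 1)}"]) (auto simp: good_def)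
    next
      case (Suc j)
      then obtain \<rho>1 \<delta> P where g: "good \<rho>1 \<delta> P" and near: "\<And>\<rho> \<phi>. transports_near L C \<rho>1 \<delta> \<rho> \<phi> \<Longrightarrow>
          \<exists>q\<in>P. stretched \<phi> ((1 + k) ^ j / L) q"
        by blast
      have "finite P" "0 < (1 + k) ^ j / L"
        using g k L by (auto simp: good_def)
      then obtain \<rho>2 \<delta>2 P' where "good \<rho>2 \<delta>2 P'" and "\<And>\<rho> \<phi>. transports_near L C \<rho>2 \<delta>2 \<rho> \<phi> \<Longrightarrow>
          transports_near L C \<rho>1 \<delta> \<rho> \<phi> \<and> ((\<exists>q\<in>P. stretched \<phi> ((1 + k) ^ j / L) q) \<longrightarrow>
            (\<exists>q\<in>P'. stretched \<phi> ((1 + k) * ((1 + k) ^ j / L)) q))"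
        using all g by meson
      moreover have "(1 + k) ^ Suc j / L = (1 + k) * ((1 + k) ^ j / L)"
        by simp
      ultimately show ?case
        using near by metis
    qed
    \<comment> \<open>One factor \<open>L\<close> offsets the initial \<open>1 / L\<close>; the
      other exceeds the upper Lipschitz constant.\<close>
    obtain j where j: "L * L < (1 + k) ^ j"
      using real_arch_pow[of "1 + k" "L * L"] k by auto
    obtain \<rho>1 \<delta> P where g: "good \<rho>1 \<delta> P" and near: "\<And>\<rho> \<phi>. transports_near L C \<rho>1 \<delta> \<rho> \<phi> \<Longrightarrow>
        \<exists>q\<in>P. stretched \<phi> ((1 + k) ^ j / L) q"
      using iter[of j] by blast
    have "\<not> transports_near L C \<rho>1 \<delta> \<rho> \<phi>" for \<rho> \<phi>
    proof
      assume tn: "transports_near L C \<rho>1 \<delta> \<rho> \<phi>"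
      then have bil: "bi_lipschitz_with L unit_square \<phi>"
        by (simp add: transports_near_def transports_def)
      obtain p l where q: "(p, l) \<in> segments" and st: "stretched \<phi> ((1 + k) ^ j / L) (p, l)"
        using near[OF tn] g by (auto simp: good_def)
      have l: "0 < l"
        using q by (simp add: segments_def)
      have "(1 + k) ^ j / L * l \<le> L * l"
        using st bi_lipschitz_with_dist_le[OF bil segments_endpoints[OF q]] l
        by (simp add: stretched_def dist_norm norm_axis_1)
      then have "(1 + k) ^ j / L \<le> L"
        using l by (rule mult_right_le_imp_le)
      then show False
        using j L by (simp add: field_simps)
    qed
    then show thesis
      using that g unfolding good_def by blast
  qed
qed

section \<open>The supremum metric and the category argument\<close>

lemma abs_diff_le_mdist_pos_cfunspace:
  assumes "f \<in> mspace pos_cfunspace" "g \<in> mspace pos_cfunspace" "x \<in> unit_square"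
  shows "\<bar>f x - g x\<bar> \<le> mdist pos_cfunspace f g"
proof -
  have "continuous_on unit_square (\<lambda>x. \<bar>f x - g x\<bar>)"
    using assms by (intro continuous_intros) (auto simp: mspace_pos_cfunspace)
  then have "compact ((\<lambda>x. \<bar>f x - g x\<bar>) ` unit_square)"
    by (intro compact_continuous_image) (auto simp: unit_square_eq_cbox)
  then have "bdd_above ((\<lambda>x. \<bar>f x - g x\<bar>) ` unit_square)"
    by (intro bounded_imp_bdd_above compact_imp_bounded)
  then show ?thesis
    unfolding mdist_pos_cfunspace[OF assms(1,2)] using assms(3) by (rule cSUP_upper2) auto
qed

lemma mdist_pos_cfunspace_le:
  assumes "f \<in> mspace pos_cfunspace" "g \<in> mspace pos_cfunspace"
    and "\<And>x. x \<in> unit_square \<Longrightarrow> \<bar>f x - g x\<bar> \<le> e"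
  shows "mdist pos_cfunspace f g \<le> e"
proof -
  have "(0::real^2) \<in> unit_square"
    by (simp add: unit_square_def)
  then show ?thesis
    unfolding mdist_pos_cfunspace[OF assms(1,2)] using assms(3) by (intro cSUP_least) auto
qed

text \<open>No constant appears since the unit square has measure one. Hence balls of the supremum
  metric lie inside the neighbourhoods in mean used by \<open>transports_near\<close>.\<close>

lemma L1_le_mdist_pos_cfunspace:
  assumes "f \<in> mspace pos_cfunspace" "g \<in> mspace pos_cfunspace"
  shows "integral unit_square (\<lambda>x. \<bar>f x - g x\<bar>) \<le> mdist pos_cfunspace f g"
proof -
  have "continuous_on unit_square (\<lambda>x. \<bar>f x - g x\<bar>)"
    using assms by (intro continuous_intros) (auto simp: mspace_pos_cfunspace)
  then have "integral unit_square (\<lambda>x. \<bar>f x - g x\<bar>)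
      \<le> integral unit_square (\<lambda>x. mdist pos_cfunspace f g)"
    using abs_diff_le_mdist_pos_cfunspace[OF assms]
    by (intro integral_le) (auto simp: unit_square_eq_cbox intro: integrable_continuous)
  moreover have "measure lborel (cbox 0 (1 :: real^2)) = 1"
    by (subst content_cbox_cart) (auto simp: interval_ne_empty_cart)
  ultimately show ?thesis
    by (simp add: unit_square_eq_cbox)
qed

definition realizable_densities :: "real \<Rightarrow> ((real^2) \<Rightarrow> real) set" where
  "realizable_densities L = {\<rho> \<in> mspace pos_cfunspace.
     \<exists>\<phi> :: real^2 \<Rightarrow> real^2. bi_lipschitz_with L unit_square \<phi> \<and> has_jacobian_ae \<phi> \<rho> unit_square}"

lemma realizable_densities_nowhere_dense:
  assumes L: "1 \<le> L" and \<rho>0: "\<rho>0 \<in> mspace pos_cfunspace" and e: "0 < e"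
  obtains \<rho>1 \<delta> where "\<rho>1 \<in> mspace pos_cfunspace" "mdist pos_cfunspace \<rho>0 \<rho>1 < e" "0 < \<delta>"
    "\<And>\<rho>. \<lbrakk>\<rho> \<in> realizable_densities L; mdist pos_cfunspace \<rho>1 \<rho> < \<delta>\<rbrakk> \<Longrightarrow> False"
proof -
  have cont0: "continuous_on unit_square \<rho>0" and pos0: "\<And>x. x \<in> unit_square \<Longrightarrow> 0 < \<rho>0 x"
    using \<rho>0 by (auto simp: mspace_pos_cfunspace)
  have cpt: "compact unit_square" "unit_square \<noteq> {}"
    by (auto simp: unit_square_eq_cbox interval_ne_empty_cart)
  obtain x0 where x0: "x0 \<in> unit_square" "\<And>x. x \<in> unit_square \<Longrightarrow> \<rho>0 x0 \<le> \<rho>0 x"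
    using continuous_attains_inf[OF cpt cont0] by blast
  obtain x1 where x1: "x1 \<in> unit_square" "\<And>x. x \<in> unit_square \<Longrightarrow> \<rho>0 x \<le> \<rho>0 x1"
    using continuous_attains_sup[OF cpt cont0] by blast
  \<comment> \<open>Half the minimum of \<rho>0 keeps the perturbed density positive. The constant
    \<open>C\<close> then bounds every density within distance \<open>1\<close> of the perturbed
    one, which explains the radius \<open>min \<delta> 1\<close> below.\<close>
  define \<epsilon> where "\<epsilon> = min (e / 2) (\<rho>0 x0 / 2)"
  define C where "C = \<rho>0 x1 + \<epsilon> + 1"
  have \<epsilon>: "0 < \<epsilon>" "\<epsilon> < e" "\<epsilon> < \<rho>0 x0"
    using e pos0[OF x0(1)] by (auto simp: \<epsilon>_def)
  have C: "0 < C"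
    using \<epsilon> pos0[OF x1(1)] by (simp add: C_def)
  obtain \<rho>1 \<delta> where \<rho>1: "continuous_on unit_square \<rho>1"
      "\<And>x. x \<in> unit_square \<Longrightarrow> \<bar>\<rho>1 x - \<rho>0 x\<bar> \<le> \<epsilon>" and \<delta>: "0 < \<delta>"
    and none: "\<And>\<rho> \<phi>. \<not> transports_near L C \<rho>1 \<delta> \<rho> \<phi>"
    using exists_density_without_near_transports[OF L C \<epsilon>(1) cont0] by metis
  \<comment> \<open>Elements of the function space are extensional, while \<rho>1 is only controlled
    on the square.\<close>
  define \<sigma> where "\<sigma> = restrict \<rho>1 unit_square"
  have \<sigma>_eq: "\<sigma> x = \<rho>1 x" if "x \<in> unit_square" for x
    using that by (simp add: \<sigma>_def)
  have "0 < \<rho>1 x" if "x \<in> unit_square" for x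
    using \<rho>1(2)[OF that] x0(2)[OF that] \<epsilon>(3) by linarith
  then have \<sigma>: "\<sigma> \<in> mspace pos_cfunspace"
    using \<rho>1(1) by (simp add: mspace_pos_cfunspace \<sigma>_def cong: continuous_on_cong)
  show thesis
  proof (rule that[OF \<sigma>])
    have "mdist pos_cfunspace \<rho>0 \<sigma> \<le> \<epsilon>"
      using \<rho>1(2) by (intro mdist_pos_cfunspace_le \<rho>0 \<sigma>) (simp add: \<sigma>_eq abs_minus_commute)
    then show "mdist pos_cfunspace \<rho>0 \<sigma> < e"
      using \<epsilon>(2) by simp
    show "0 < min \<delta> 1"
      using \<delta> by simp
    fix \<rho> assume \<rho>R: "\<rho> \<in> realizable_densities L" and near: "mdist pos_cfunspace \<sigma> \<rho> < min \<delta> 1"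
    then obtain \<phi> :: "real^2 \<Rightarrow> real^2" where \<rho>: "\<rho> \<in> mspace pos_cfunspace"
      and \<phi>: "bi_lipschitz_with L unit_square \<phi>" "has_jacobian_ae \<phi> \<rho> unit_square"
      by (auto simp: realizable_densities_def)
    have \<rho>': "continuous_on unit_square \<rho>" "\<And>x. x \<in> unit_square \<Longrightarrow> 0 < \<rho> x"
      using \<rho> by (auto simp: mspace_pos_cfunspace)
    have "\<rho> x \<le> C" if "x \<in> unit_square" for x
      using abs_diff_le_mdist_pos_cfunspace[OF \<sigma> \<rho> that] near \<sigma>_eq[OF that] \<rho>1(2)[OF that] x1(2)[OF that]
      unfolding C_def by linarith
    moreover have "integral unit_square (\<lambda>x. \<bar>\<rho> x - \<rho>1 x\<bar>) = integral unit_square (\<lambda>x. \<bar>\<sigma> x - \<rho> x\<bar>)"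
      by (rule Henstock_Kurzweil_Integration.integral_cong) (simp add: \<sigma>_eq abs_minus_commute)
    then have "integral unit_square (\<lambda>x. \<bar>\<rho> x - \<rho>1 x\<bar>) < \<delta>"
      using L1_le_mdist_pos_cfunspace[OF \<sigma> \<rho>] near by linarith
    ultimately show False
      using none transports_of_jacobian[OF L \<phi> \<rho>'] \<rho>'(1) unfolding transports_near_def by blast
  qed
qed

theorem theorem1:
  shows "thick_in pos_cfunspace nonrealizable_densities"
proof -
  let ?X = "mtopology_of pos_cfunspace" and ?M = "mspace pos_cfunspace"
  let ?R = "\<lambda>n. realizable_densities (real n + 1)"
  \<comment> \<open>The complement of the closure is open, and it is dense because
    \<open>?R n\<close> is nowhere dense. The constants \<open>real n + 1\<close> are at least
    \<open>1\<close> and eventually exceed any given \<open>L\<close>.\<close>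
  define U where "U n = ?M - ?X closure_of ?R n" for n
  interpret M: Metric_space ?M "mdist pos_cfunspace"
    by (rule Metric_space_mspace_mdist)
  have X: "?X = M.mtopology"
    by (simp add: mtopology_of_def)
  have "openin ?X (U n)" for n
    unfolding U_def using closedin_closure_of[of ?X "?R n"]
    by (simp add: closedin_def X)
  moreover have "?X closure_of U n = ?M" for n
  proof
    show "?X closure_of U n \<subseteq> ?M"
      using closure_of_subset_topspace[of ?X] by (simp add: X)
    show "?M \<subseteq> ?X closure_of U n"
    proof
      fix \<rho>0 assume \<rho>0: "\<rho>0 \<in> ?M"
      have "\<exists>\<rho>\<in>U n. \<rho> \<in> M.mball \<rho>0 e" if e: "0 < e" for e
      proof -
        obtain \<rho>1 \<delta> where \<rho>1: "\<rho>1 \<in> ?M" "mdist pos_cfunspace \<rho>0 \<rho>1 < e" and \<delta>: "0 < \<delta>"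
          and none: "\<And>\<rho>. \<lbrakk>\<rho> \<in> ?R n; mdist pos_cfunspace \<rho>1 \<rho> < \<delta>\<rbrakk> \<Longrightarrow> False"
          using realizable_densities_nowhere_dense[of "real n + 1", OF _ \<rho>0 e] by auto
        \<comment> \<open>The ball of radius \<delta> around \<rho>1 misses
          \<open>?R n\<close>.\<close>
        have "\<rho>1 \<notin> ?X closure_of ?R n"
          using \<delta> none unfolding X M.metric_closure_of by (auto simp: M.in_mball)
        then show ?thesis
          using \<rho>0 \<rho>1 by (auto simp: U_def M.in_mball)
      qed
      then show "\<rho>0 \<in> ?X closure_of U n"
        using \<rho>0 unfolding X M.metric_closure_of by auto
    qed
  qed
  moreover have "(\<Inter>n. U n) \<subseteq> nonrealizable_densities"
  proof
    fix \<rho> assume \<rho>: "\<rho> \<in> (\<Inter>n. U n)"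
    then have \<rho>M: "\<rho> \<in> ?M"
      by (auto simp: U_def)
    have "\<not> (bi_lipschitz_on unit_square \<phi> \<and> has_jacobian_ae \<phi> \<rho> unit_square)"
      for \<phi> :: "real^2 \<Rightarrow> real^2"
    proof
      assume \<phi>: "bi_lipschitz_on unit_square \<phi> \<and> has_jacobian_ae \<phi> \<rho> unit_square"
      then obtain L where L: "1 \<le> L" "bi_lipschitz_with L unit_square \<phi>"
        by (auto simp: bi_lipschitz_on_def)
      obtain n :: nat where "L \<le> real n"
        using real_arch_simple by blast
      then have "bi_lipschitz_with (real n + 1) unit_square \<phi>"
        using bi_lipschitz_with_mono[OF L(2,1)] by simp
      then have "\<rho> \<in> ?R n"
        using \<phi> \<rho>M by (auto simp: realizable_densities_def)
      moreover have "?R n \<subseteq> ?X closure_of ?R n"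
        by (rule closure_of_subset) (auto simp: X realizable_densities_def)
      ultimately show False
        using \<rho> by (auto simp: U_def)
    qed
    then show "\<rho> \<in> nonrealizable_densities"
      using \<rho>M by (simp add: nonrealizable_densities_def)
  qed
  moreover have "nonrealizable_densities \<subseteq> ?M"
    by (auto simp: nonrealizable_densities_def)
  ultimately show ?thesis
    unfolding thick_in_def by blast
qed

end
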